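(* Let $\lambda,m,n,k$ and $c_1,\dots,c_k$ be positive integers and assume there exists a $(c_1,\dots,c_k)$-cycle decomposition of $\lambda m K_n$. Let $C_i$ be the cycle of length $c_i$ in this decomposition, and assume that the cycles $C_1,C_2,\ldots,C_k$ have been ordered so that for some integer $N$ with $1\le N<k$, for all $i\le N$, the cycle $C_i$ possesses a vertex not in $\bigcup_{j=1}^{i-1}V(C_j)$. For all $i\in\{1,\ldots,N\}$, let $r_i$ and $q_{i,1},\ldots,q_{i,r_i}$ be positive integers such that $q_{i,1}+\ldots+q_{i,r_i}=m$, and such that if $\lambda=1$ and $c_i=2$, then $q_{i,j}\ge 2$ for each $j\in\{1,\ldots,r_i\}$. Then the complete equipartite multigraph $\lambda K_{n\times m}$ can be decomposed into subgraphs $F_1,\ldots,F_k$, plus a 1-factor if $\lambda m(n-1)$ is odd, such that \begin{itemize} \item for all $i\in\{1,\ldots,k\}$, the subgraph $F_i$ is 2-regular and has $c_im$ edges, and \item for all $i\in\{1,\ldots,N\}$, the subgraph $F_i$ is a vertex-disjoint union of cycles of lengths $q_{i,1}c_i,\ldots,q_{i,r_i}c_i$. \end{itemize}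
   Context: All graphs are finite, loopless and undirected, possibly with multiple (parallel) edges. $K_n$ is the complete graph on $n$ vertices, and $K_{n\times m}$ is the complete $n$-partite graph with all $n$ parts of cardinality $m$. For a simple graph $\mathcal G$ and a positive integer $\mu$, $\mu\mathcal G$ denotes the multigraph with underlying simple graph $\mathcal G$ in which every edge has multiplicity $\mu$. A cycle of length $c\ge 2$ is a connected 2-regular graph with $c$ edges (a cycle of length 2 consists of two distinct parallel edges between two vertices). A 1-factor of a graph is a spanning 1-regular subgraph. Subgraphs (in particular the $F_i$) need not be spanning. A decomposition of a graph $\mathcal G$ is a collection of subgraphs of $\mathcal G$ whose edge sets partition the edge set of $\mathcal G$. A $(c_1,\ldots,c_k)$-cycle decomposition of $\mathcal G$ is a decomposition of $\mathcal G$ into $k$ cycles of lengths $c_1,\dots,c_k$, respectively, if every vertex of $\mathcal G$ has even degree, and a decomposition of $\mathcal G$ into $k$ cycles of lengths $c_1,\dots,c_k$ plus a 1-factor if every vertex of $\mathcal G$ has odd degree. *)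

theory Defs
  imports Main "HOL-Library.Disjoint_Sets"
begin

text \<open>Edges are objects of their own, so that parallel edges are distinct edges with the
  same set of end vertices.\<close>

record ('v, 'e) mgraph =
  verts :: "'v set"
  edges :: "'e set"
  ends :: "'e \<Rightarrow> 'v set"

definition multigraph :: "('v, 'e) mgraph \<Rightarrow> bool" where
  "multigraph G \<longleftrightarrow> finite (verts G) \<and> finite (edges G) \<and>
     (\<forall>e\<in>edges G. ends G e \<subseteq> verts G \<and> card (ends G e) = 2)"

definition subgraph :: "('v, 'e) mgraph \<Rightarrow> ('v, 'e) mgraph \<Rightarrow> bool" where
  "subgraph H G \<longleftrightarrow> multigraph H \<and> multigraph G \<and>
     verts H \<subseteq> verts G \<and> edges H \<subseteq> edges G \<and> (\<forall>e\<in>edges H. ends H e = ends G e)"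

definition degree :: "('v, 'e) mgraph \<Rightarrow> 'v \<Rightarrow> nat" where
  "degree G v = card {e \<in> edges G. v \<in> ends G e}"

definition regular :: "nat \<Rightarrow> ('v, 'e) mgraph \<Rightarrow> bool" where
  "regular d G \<longleftrightarrow> (\<forall>v\<in>verts G. degree G v = d)"

definition adjacency :: "('v, 'e) mgraph \<Rightarrow> ('v \<times> 'v) set" where
  "adjacency G = {(u, v). \<exists>e\<in>edges G. ends G e = {u, v}}"

definition connected_graph :: "('v, 'e) mgraph \<Rightarrow> bool" where
  "connected_graph G \<longleftrightarrow> verts G \<noteq> {} \<and>
     (\<forall>u\<in>verts G. \<forall>v\<in>verts G. (u, v) \<in> (adjacency G)\<^sup>*)"

definition is_cycle :: "nat \<Rightarrow> ('v, 'e) mgraph \<Rightarrow> bool" where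
  "is_cycle c G \<longleftrightarrow> c \<ge> 2 \<and> multigraph G \<and> connected_graph G \<and> regular 2 G \<and>
     card (edges G) = c"

definition one_factor :: "('v, 'e) mgraph \<Rightarrow> ('v, 'e) mgraph \<Rightarrow> bool" where
  "one_factor H G \<longleftrightarrow> subgraph H G \<and> verts H = verts G \<and> regular 1 H"

definition decomposition :: "('v, 'e) mgraph \<Rightarrow> 'i set \<Rightarrow> ('i \<Rightarrow> ('v, 'e) mgraph) \<Rightarrow> bool" where
  "decomposition G A H \<longleftrightarrow> (\<forall>i\<in>A. subgraph (H i) G) \<and>
     disjoint_family_on (\<lambda>i. edges (H i)) A \<and> (\<Union>i\<in>A. edges (H i)) = edges G"

text \<open>Decomposition into the \<open>H i\<close> plus a 1-factor, the latter being indexed by \<open>None\<close>.\<close>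

definition decomposition_plus_one_factor ::
    "('v, 'e) mgraph \<Rightarrow> 'i set \<Rightarrow> ('i \<Rightarrow> ('v, 'e) mgraph) \<Rightarrow> bool" where
  "decomposition_plus_one_factor G A H \<longleftrightarrow>
     (\<exists>J. one_factor J G \<and> decomposition G (insert None (Some ` A)) (case_option J H))"

definition cycle_decomposition ::
    "('v, 'e) mgraph \<Rightarrow> nat \<Rightarrow> (nat \<Rightarrow> nat) \<Rightarrow> (nat \<Rightarrow> ('v, 'e) mgraph) \<Rightarrow> bool" where
  "cycle_decomposition G k c C \<longleftrightarrow>
     (\<forall>i\<in>{1..k}. is_cycle (c i) (C i)) \<and>
     ((\<forall>v\<in>verts G. even (degree G v)) \<and> decomposition G {1..k} C \<or>
      (\<forall>v\<in>verts G. odd (degree G v)) \<and> decomposition_plus_one_factor G {1..k} C)"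

definition vertex_disjoint_union ::
    "('v, 'e) mgraph \<Rightarrow> 'i set \<Rightarrow> ('i \<Rightarrow> ('v, 'e) mgraph) \<Rightarrow> bool" where
  "vertex_disjoint_union G A D \<longleftrightarrow> (\<forall>j\<in>A. subgraph (D j) G) \<and>
     disjoint_family_on (\<lambda>j. verts (D j)) A \<and>
     verts G = (\<Union>j\<in>A. verts (D j)) \<and> edges G = (\<Union>j\<in>A. edges (D j))"

definition complete_graph :: "nat \<Rightarrow> (nat, nat set) mgraph" where
  "complete_graph n = \<lparr>verts = {..<n},
     edges = {{u, v} | u v. u < n \<and> v < n \<and> u \<noteq> v}, ends = id\<rparr>"

text \<open>The vertex \<open>(i, a)\<close> is the \<open>a\<close>-th vertex of the \<open>i\<close>-th part.\<close>

definition complete_equipartite_graph :: "nat \<Rightarrow> nat \<Rightarrow> (nat \<times> nat, (nat \<times> nat) set) mgraph" where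
  "complete_equipartite_graph n m = \<lparr>verts = {..<n} \<times> {..<m},
     edges = {{u, v} | u v. u \<in> {..<n} \<times> {..<m} \<and> v \<in> {..<n} \<times> {..<m} \<and> fst u \<noteq> fst v},
     ends = id\<rparr>"

text \<open>Replaces every edge \<open>e\<close> by the parallel edges \<open>(e, 0), \<dots>, (e, \<mu> - 1)\<close>.\<close>

definition multiple :: "nat \<Rightarrow> ('v, 'e) mgraph \<Rightarrow> ('v, 'e \<times> nat) mgraph" where
  "multiple \<mu> G = \<lparr>verts = verts G, edges = edges G \<times> {..<\<mu>}, ends = ends G \<circ> fst\<rparr>"

lemma multigraph_complete_graph: "multigraph (complete_graph n)"
proof -
  have "{{u, v} | u v. u < n \<and> v < n \<and> u \<noteq> v} \<subseteq> Pow {..<n}" by auto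
  then have "finite {{u, v} | u v. u < n \<and> v < n \<and> u \<noteq> v}"
    by (rule finite_subset) simp
  then show ?thesis by (auto simp: multigraph_def complete_graph_def)
qed

lemma multigraph_complete_equipartite_graph: "multigraph (complete_equipartite_graph n m)"
proof -
  let ?V = "{..<n} \<times> {..<m}"
  have "{{u, v} | u v. u \<in> ?V \<and> v \<in> ?V \<and> fst u \<noteq> fst v} \<subseteq> Pow ?V" by auto
  then have "finite {{u, v} | u v. u \<in> ?V \<and> v \<in> ?V \<and> fst u \<noteq> fst v}"
    by (rule finite_subset) simp
  then show ?thesis
    by (fastforce simp: multigraph_def complete_equipartite_graph_def card_2_iff)
qed

lemma multigraph_multiple: "multigraph G \<Longrightarrow> multigraph (multiple \<mu> G)"
  by (auto simp: multigraph_def multiple_def)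

end

theory Submission imports Defs begin

text \<open>
  Put a vertex \<open>u\<close> of \<open>K\<^sub>n\<close> in correspondence with the part \<open>{u} \<times> {..<m}\<close> of the equipartite graph.
  Between two parts there are \<open>\<lambda>m\<^sup>2\<close> edges, and between two vertices of \<open>\<lambda>mK\<^sub>n\<close> there are \<open>\<lambda>m\<close>
  parallel edges; splitting the former into \<open>\<lambda>m\<close> perfect matchings, for each pair of parts, lets
  every edge of \<open>\<lambda>mK\<^sub>n\<close> stand for one perfect matching. A subgraph of \<open>\<lambda>mK\<^sub>n\<close> then lifts to the
  union of its matchings, and the lift keeps degrees (\<open>degree_lift\<close>) and turns decompositions into
  decompositions (\<open>decomposition_lift\<close>). So any choice of the matchings lifts the cycles \<open>C\<^sub>i\<close>
  to 2-regular graphs with \<open>c\<^sub>i m\<close> edges, and the 1-factor to a 1-factor.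

  How the lift of a cycle splits into cycles depends on its monodromy, the product of the matchings
  around the cycle, read as permutations of \<open>{..<m}\<close>: a monodromy with cycles of lengths
  \<open>q\<^sub>1, \<dots>, q\<^sub>r\<close> yields cycles of lengths \<open>q\<^sub>1c, \<dots>, q\<^sub>rc\<close> (\<open>lift_of_cycle\<close>). The matchings are chosen so
  that the first \<open>N\<close> monodromies are as required. For \<open>i = 1, \<dots>, N\<close> in turn, let \<open>v\<close> be a vertex of
  \<open>C\<^sub>i\<close> outside the earlier cycles and \<open>a\<close> a neighbour of \<open>v\<close> on \<open>C\<^sub>i\<close>. The matchings between \<open>v\<close> and \<open>a\<close>
  are chosen afresh (\<open>redo_pair_for_cycle\<close>), which leaves the lifts of the earlier cycles alone as
  these miss \<open>v\<close>. If \<open>c\<^sub>i \<ge> 3\<close>, only one edge of \<open>C\<^sub>i\<close> joins \<open>v\<close> and \<open>a\<close>, and prescribing its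
  matching suffices. If \<open>c\<^sub>i = 2\<close>, both edges of \<open>C\<^sub>i\<close> join \<open>v\<close> and \<open>a\<close>, and they are given the identity
  and the wanted permutation; for \<open>\<lambda> = 1\<close> these two matchings have to be disjoint, which is where
  \<open>q\<^sub>i\<^sub>,\<^sub>j \<ge> 2\<close> enters.

  That one or two prescribed matchings extend to a full splitting of the edges between two parts is
  the completion of a Latin rectangle, generalized to multiplicity \<open>\<lambda>\<close>
  (\<open>latin_rectangle_completion\<close>); it follows from Hall's marriage theorem.
\<close>

section \<open>Latin rectangles\<close>

text \<open>The proof of Halmos and Vaughan. Either every proper nonempty subfamily has an element to
  spare, so that any choice for one index leaves Hall's condition intact, or some proper
  subfamily \<open>J\<close> exhausts its elements, and then Hall's condition holds both on \<open>J\<close> and, after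
  removing the elements of \<open>J\<close>, on the rest.\<close>

lemma hall_marriage:
  assumes "finite I" "\<forall>i\<in>I. finite (A i)" "\<forall>J\<subseteq>I. card J \<le> card (\<Union>(A ` J))"
  shows "\<exists>f. inj_on f I \<and> (\<forall>i\<in>I. f i \<in> A i)"
  using assms
proof (induction "card I" arbitrary: I A rule: less_induct)
  case less
  note fin = less.prems(1) and finA = less.prems(2) and hall = less.prems(3)
  consider "I = {}"
    | i where "i \<in> I" "\<And>J. J \<subset> I \<Longrightarrow> J \<noteq> {} \<Longrightarrow> card J < card (\<Union>(A ` J))"
    | J where "J \<subset> I" "J \<noteq> {}" "card J = card (\<Union>(A ` J))"
  proof -
    have "card J < card (\<Union>(A ` J))" if "J \<subset> I" "card J \<noteq> card (\<Union>(A ` J))" for J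
      using hall that by (metis le_neq_implies_less psubset_imp_subset)
    then show ?thesis using that by blast
  qed
  then show ?case
  proof cases
    case 1
    then show ?thesis by simp
  next
    case (2 i)
    have "card {i} \<le> card (\<Union>(A ` {i}))" using hall 2(1) by blast
    then obtain x where x: "x \<in> A i" by fastforce
    have "\<exists>f. inj_on f (I - {i}) \<and> (\<forall>j\<in>I - {i}. f j \<in> A j - {x})"
    proof (rule less.hyps)
      show "card (I - {i}) < card I" using 2(1) fin by (rule card_Diff1_less[rotated])
      show "finite (I - {i})" "\<forall>j\<in>I - {i}. finite (A j - {x})" using fin finA by auto
      show "\<forall>J\<subseteq>I - {i}. card J \<le> card (\<Union>j\<in>J. A j - {x})"
      proof (intro allI impI)
        fix J assume J: "J \<subseteq> I - {i}"
        show "card J \<le> card (\<Union>j\<in>J. A j - {x})"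
        proof (cases "J = {}")
          case False
          have "J \<subset> I" using J 2(1) by auto
          then have "card J < card (\<Union>(A ` J))" using 2(2) False by blast
          moreover have "(\<Union>j\<in>J. A j - {x}) = \<Union>(A ` J) - {x}" by auto
          ultimately show ?thesis using diff_card_le_card_Diff[of "{x}" "\<Union>(A ` J)"] by simp
        qed simp
      qed
    qed
    then obtain f where f: "inj_on f (I - {i})" "\<forall>j\<in>I - {i}. f j \<in> A j - {x}" by blast
    have "inj_on (f(i := x)) I" using f by (auto simp: inj_on_def)
    moreover have "\<forall>j\<in>I. (f(i := x)) j \<in> A j" using f x by auto
    ultimately show ?thesis by blast
  next
    case (3 J)
    let ?B = "\<Union>(A ` J)"
    have finJ: "finite J" using 3(1) fin by (auto intro: finite_subset)
    have "\<exists>f. inj_on f J \<and> (\<forall>j\<in>J. f j \<in> A j)"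
      using 3(1) finJ finA hall fin by (intro less.hyps) (auto intro: psubset_card_mono)
    then obtain f where f: "inj_on f J" "\<forall>j\<in>J. f j \<in> A j" by blast
    have "\<exists>g. inj_on g (I - J) \<and> (\<forall>j\<in>I - J. g j \<in> A j - ?B)"
    proof (rule less.hyps)
      show "card (I - J) < card I" using 3(1,2) fin by (intro psubset_card_mono) auto
      show "finite (I - J)" "\<forall>j\<in>I - J. finite (A j - ?B)" using fin finA by auto
      show "\<forall>K\<subseteq>I - J. card K \<le> card (\<Union>j\<in>K. A j - ?B)"
      proof (intro allI impI)
        fix K assume K: "K \<subseteq> I - J"
        then have finK: "finite K" using fin by (auto intro: finite_subset)
        have "card (K \<union> J) \<le> card (\<Union>(A ` (K \<union> J)))" using hall K 3(1) by (intro hall[rule_format]) auto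
        also have "\<Union>(A ` (K \<union> J)) = (\<Union>j\<in>K. A j - ?B) \<union> ?B" by auto
        also have "card \<dots> \<le> card (\<Union>j\<in>K. A j - ?B) + card ?B" by (rule card_Un_le)
        also have "card (K \<union> J) = card K + card J"
          using K finK finJ by (intro card_Un_disjoint) auto
        finally show "card K \<le> card (\<Union>j\<in>K. A j - ?B)" using 3(3) by simp
      qed
    qed
    then obtain g where g: "inj_on g (I - J)" "\<forall>j\<in>I - J. g j \<in> A j - ?B" by blast
    let ?h = "\<lambda>j. if j \<in> J then f j else g j"
    have "inj_on ?h I"
    proof (rule inj_onI)
      fix x y assume xy: "x \<in> I" "y \<in> I" "?h x = ?h y"
      have "f j \<noteq> g j'" if "j \<in> J" "j' \<in> I - J" for j j' using f(2) g(2) that by force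
      then show "x = y"
        using xy inj_onD[OF f(1), of x y] inj_onD[OF g(1), of x y] by (auto split: if_splits) metis+
    qed
    moreover have "\<forall>j\<in>I. ?h j \<in> A j" using f g by auto
    ultimately show ?thesis by blast
  qed
qed

text \<open>A matrix of natural numbers is a bipartite multigraph; constant line sums say that it is
  regular, and the permutation is a perfect matching. Hall's condition holds because the rows in
  \<open>J\<close> have total weight \<open>d \<cdot> card J\<close>, all of it in the columns that they meet, whose
  total weight is \<open>d\<close> per column.\<close>

lemma regular_matrix_permutation:
  fixes A :: "nat \<Rightarrow> nat \<Rightarrow> nat"
  assumes "d > 0" and row: "\<And>x. x < m \<Longrightarrow> (\<Sum>y<m. A x y) = d"
    and col: "\<And>y. y < m \<Longrightarrow> (\<Sum>x<m. A x y) = d"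
  shows "\<exists>\<pi>. bij_betw \<pi> {..<m} {..<m} \<and> (\<forall>x<m. A x (\<pi> x) > 0)"
proof -
  let ?S = "\<lambda>x. {y. y < m \<and> A x y > 0}"
  have "\<exists>f. inj_on f {..<m} \<and> (\<forall>x\<in>{..<m}. f x \<in> ?S x)"
  proof (rule hall_marriage)
    show "\<forall>J\<subseteq>{..<m}. card J \<le> card (\<Union>(?S ` J))"
    proof (intro allI impI)
      fix J assume J: "J \<subseteq> {..<m}"
      let ?B = "\<Union>(?S ` J)"
      have fin: "finite J" "finite ?B" using J by (auto intro: finite_subset[of _ "{..<m}"])
      have "card J * d = (\<Sum>x\<in>J. \<Sum>y<m. A x y)" using row J by (simp add: subset_iff)
      also have "\<dots> = (\<Sum>x\<in>J. \<Sum>y\<in>?B. A x y)"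
        by (intro sum.cong[OF refl] sum.mono_neutral_right) auto
      also have "\<dots> = (\<Sum>y\<in>?B. \<Sum>x\<in>J. A x y)" by (rule sum.swap)
      also have "\<dots> \<le> (\<Sum>y\<in>?B. \<Sum>x<m. A x y)"
        using J by (intro sum_mono sum_mono2) auto
      also have "\<dots> = card ?B * d" using col by simp
      finally show "card J \<le> card ?B" using \<open>d > 0\<close> by simp
    qed
  qed auto
  then obtain f where f: "inj_on f {..<m}" "\<forall>x\<in>{..<m}. f x \<in> ?S x" by blast
  moreover have "f ` {..<m} = {..<m}" using f by (intro endo_inj_surj) auto
  ultimately show ?thesis by (auto simp: bij_betw_def)
qed

text \<open>For \<open>lam = 1\<close> this says that a Latin rectangle extends to a Latin square. The numbers of times
  that the pairs \<open>(x, y)\<close> may still be used form a matrix with constant line sums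
  \<open>lam * m - card T\<close>, so as long as rows are missing there is a permutation that can be added.\<close>

lemma latin_rectangle_completion:
  fixes \<pi> :: "nat \<Rightarrow> nat \<Rightarrow> nat"
  assumes "T \<subseteq> {..<lam * m}" and "\<And>t. t \<in> T \<Longrightarrow> bij_betw (\<pi> t) {..<m} {..<m}"
    and "\<And>x y. x < m \<Longrightarrow> y < m \<Longrightarrow> card {t \<in> T. \<pi> t x = y} \<le> lam"
  shows "\<exists>\<pi>'. (\<forall>t\<in>T. \<pi>' t = \<pi> t) \<and> (\<forall>t<lam * m. bij_betw (\<pi>' t) {..<m} {..<m}) \<and>
    (\<forall>x<m. \<forall>y<m. card {t. t < lam * m \<and> \<pi>' t x = y} = lam)"
  using assms
proof (induction "card ({..<lam * m} - T)" arbitrary: T \<pi>)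
  case 0
  have T: "T = {..<lam * m}" using 0(1,2) by auto
  have "card {t. t < lam * m \<and> \<pi> t x = y} = lam" if "x < m" "y < m" for x y
  proof -
    let ?n = "\<lambda>y. card {t. t < lam * m \<and> \<pi> t x = y}"
    have "(\<Sum>y<m. ?n y) = card (\<Union>y<m. {t. t < lam * m \<and> \<pi> t x = y})"
      by (rule card_UN_disjoint[symmetric]) auto
    also have "(\<Union>y<m. {t. t < lam * m \<and> \<pi> t x = y}) = {..<lam * m}"
      using 0(3) that T by (auto simp: bij_betw_def)
    finally have sum: "(\<Sum>y<m. ?n y) = (\<Sum>y<m. lam)" by simp
    have le: "?n z \<le> lam" if "z < m" for z
      using 0(4)[OF \<open>x < m\<close> that] by (simp add: T)
    show ?thesis
      using sum_mono_inv[OF sum, of y] le \<open>y < m\<close> by simp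
  qed
  then show ?case using 0(3) T by (intro exI[of _ \<pi>]) auto
next
  case (Suc n)
  have finT: "finite T" using Suc.prems(1) by (rule finite_subset) simp
  from Suc.hyps(2) obtain t where t: "t < lam * m" "t \<notin> T"
    by (metis Diff_eq_empty_iff card.empty lessThan_iff nat.distinct(1) subsetI)
  let ?A = "\<lambda>x y. lam - card {t \<in> T. \<pi> t x = y}"
  have cT: "card T < lam * m"
    using psubset_card_mono[of "{..<lam * m}" T] Suc.prems(1) t by auto
  have "\<exists>p. bij_betw p {..<m} {..<m} \<and> (\<forall>x<m. ?A x (p x) > 0)"
  proof (rule regular_matrix_permutation)
    show "lam * m - card T > 0" using cT by simp
  next
    fix x assume x: "x < m"
    have "(\<Sum>y<m. ?A x y) = (\<Sum>y<m. lam) - (\<Sum>y<m. card {t \<in> T. \<pi> t x = y})"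
      using Suc.prems(3) x by (intro sum_subtractf_nat) auto
    also have "(\<Sum>y<m. card {t \<in> T. \<pi> t x = y}) = card (\<Union>y<m. {t \<in> T. \<pi> t x = y})"
      using finT by (intro card_UN_disjoint[symmetric]) auto
    also have "(\<Union>y<m. {t \<in> T. \<pi> t x = y}) = T"
      using Suc.prems(2) x by (fastforce simp: bij_betw_def)
    finally show "(\<Sum>y<m. ?A x y) = lam * m - card T" by (simp add: mult.commute)
  next
    fix y assume y: "y < m"
    have "(\<Sum>x<m. ?A x y) = (\<Sum>x<m. lam) - (\<Sum>x<m. card {t \<in> T. \<pi> t x = y})"
      using Suc.prems(3) y by (intro sum_subtractf_nat) auto
    also have "(\<Sum>x<m. card {t \<in> T. \<pi> t x = y}) = card (\<Union>x<m. {t \<in> T. \<pi> t x = y})"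
    proof (rule card_UN_disjoint[symmetric])
      show "\<forall>x\<in>{..<m}. \<forall>x'\<in>{..<m}. x \<noteq> x' \<longrightarrow> {t \<in> T. \<pi> t x = y} \<inter> {t \<in> T. \<pi> t x' = y} = {}"
        using bij_betw_imp_inj_on[OF Suc.prems(2)] by (fastforce simp: inj_on_def)
    qed (use finT in auto)
    also have "(\<Union>x<m. {t \<in> T. \<pi> t x = y}) = T"
    proof -
      have "\<exists>x<m. \<pi> t x = y" if "t \<in> T" for t
        using bij_betw_imp_surj_on[OF Suc.prems(2)[OF that]] y
        by (metis imageE lessThan_iff)
      then show ?thesis by auto
    qed
    finally show "(\<Sum>x<m. ?A x y) = lam * m - card T" by (simp add: mult.commute)
  qed
  then obtain p where p: "bij_betw p {..<m} {..<m}" "\<And>x. x < m \<Longrightarrow> ?A x (p x) > 0" by blast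
  have "\<exists>\<pi>'. (\<forall>s\<in>insert t T. \<pi>' s = (\<pi>(t := p)) s) \<and>
    (\<forall>t<lam * m. bij_betw (\<pi>' t) {..<m} {..<m}) \<and>
    (\<forall>x<m. \<forall>y<m. card {t. t < lam * m \<and> \<pi>' t x = y} = lam)"
  proof (rule Suc.hyps(1))
    have "{..<lam * m} - insert t T = ({..<lam * m} - T) - {t}" by auto
    then show "n = card ({..<lam * m} - insert t T)"
      using Suc.hyps(2) t by simp
    show "insert t T \<subseteq> {..<lam * m}" using Suc.prems(1) t by auto
    show "bij_betw ((\<pi>(t := p)) s) {..<m} {..<m}" if "s \<in> insert t T" for s
      using that p(1) Suc.prems(2) by auto
    fix x y assume xy: "x < m" "y < m"
    have "{s \<in> insert t T. (\<pi>(t := p)) s x = y}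
        = (if p x = y then insert t {s \<in> T. \<pi> s x = y} else {s \<in> T. \<pi> s x = y})"
      using t by auto
    then show "card {s \<in> insert t T. (\<pi>(t := p)) s x = y} \<le> lam"
      using Suc.prems(3)[OF xy] p(2)[OF xy(1)] finT t(2) by (auto simp: card_insert_if)
  qed
  then obtain \<pi>' where \<pi>': "\<forall>s\<in>insert t T. \<pi>' s = (\<pi>(t := p)) s"
    "\<forall>t<lam * m. bij_betw (\<pi>' t) {..<m} {..<m}"
    "\<forall>x<m. \<forall>y<m. card {t. t < lam * m \<and> \<pi>' t x = y} = lam" by blast
  have "\<forall>s\<in>T. \<pi>' s = \<pi> s" using \<pi>'(1) t(2) by auto
  then show ?case using \<pi>'(2,3) by blast
qed

section \<open>Cycles as cyclic sequences\<close>

lemma degree_sum: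
  assumes "multigraph G"
  shows "(\<Sum>v\<in>verts G. degree G v) = 2 * card (edges G)"
proof -
  have fin: "finite (verts G)" "finite (edges G)"
    and en: "\<And>e. e \<in> edges G \<Longrightarrow> ends G e \<subseteq> verts G \<and> card (ends G e) = 2"
    using assms by (auto simp: multigraph_def)
  have "(\<Sum>v\<in>verts G. degree G v) = (\<Sum>v\<in>verts G. \<Sum>e\<in>edges G. if v \<in> ends G e then 1 else 0)"
    using fin by (simp add: degree_def sum.If_cases Int_def)
  also have "\<dots> = (\<Sum>e\<in>edges G. \<Sum>v\<in>verts G. if v \<in> ends G e then 1 else 0)" by (rule sum.swap)
  also have "\<dots> = (\<Sum>e\<in>edges G. 2)"
  proof (rule sum.cong[OF refl])
    fix e assume e: "e \<in> edges G"
    have "verts G \<inter> {v. v \<in> ends G e} = ends G e" using en[OF e] by auto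
    then show "(\<Sum>v\<in>verts G. if v \<in> ends G e then 1 else 0) = (2::nat)"
      using fin en[OF e] by (simp add: sum.If_cases)
  qed
  finally show ?thesis by simp
qed

lemma card_edges_2_regular:
  assumes "multigraph G" "regular 2 G"
  shows "card (edges G) = card (verts G)"
  using degree_sum[OF assms(1)] assms(2) by (simp add: regular_def)

text \<open>A set that is closed under adjacency absorbs everything reachable from it; this identifies
  the vertices of a connected graph with the set traversed by a maximal path.\<close>

lemma connected_graph_closed:
  assumes "connected_graph G" "S \<subseteq> verts G" "S \<noteq> {}"
    and "\<And>e. e \<in> edges G \<Longrightarrow> ends G e \<inter> S \<noteq> {} \<Longrightarrow> ends G e \<subseteq> S"
  shows "S = verts G"
proof -
  obtain s where s: "s \<in> S" using assms by auto
  have "u \<in> S" if "(s, u) \<in> (adjacency G)\<^sup>*" for u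
    using that
  proof (induction rule: rtrancl_induct)
    case (step x y)
    then obtain e where "e \<in> edges G" "ends G e = {x, y}" by (auto simp: adjacency_def)
    then show ?case using assms(4)[of e] step by auto
  qed (rule s)
  then show ?thesis using assms(1,2) s by (auto simp: connected_graph_def)
qed

definition open_path :: "('v, 'e) mgraph \<Rightarrow> 'v \<Rightarrow> nat \<Rightarrow> (nat \<Rightarrow> 'v) \<Rightarrow> (nat \<Rightarrow> 'e) \<Rightarrow> bool" where
  "open_path G v p w e \<longleftrightarrow> w 0 = v \<and> inj_on w {..p} \<and>
     (\<forall>j<p. e j \<in> edges G \<and> ends G (e j) = {w j, w (Suc j)})"

text \<open>Take a longest path starting at \<open>v\<close>. Its last vertex has a second edge, whose other end is on the
  path by maximality and, since all degrees are 2, can only be \<open>v\<close>. The resulting closed walk uses up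
  the degree of all of its vertices, so by connectedness it is the whole graph.\<close>

lemma cycle_sequence:
  assumes G: "is_cycle c G" and v: "v \<in> verts G"
  shows "\<exists>w e. w 0 = v \<and> bij_betw w {..<c} (verts G) \<and> bij_betw e {..<c} (edges G) \<and>
    (\<forall>j<c. ends G (e j) = {w j, w (Suc j mod c)})"
proof -
  have mg: "multigraph G" and reg: "regular 2 G" and cE: "card (edges G) = c"
    and con: "connected_graph G" using G by (auto simp: is_cycle_def)
  have finV: "finite (verts G)" and finE: "finite (edges G)"
    and en: "\<And>f. f \<in> edges G \<Longrightarrow> ends G f \<subseteq> verts G \<and> card (ends G f) = 2"
    using mg by (auto simp: multigraph_def)
  have deg: "card {f \<in> edges G. u \<in> ends G f} = 2" if "u \<in> verts G" for u
    using reg that by (auto simp: regular_def degree_def)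
  have wV: "w j \<in> verts G" if "open_path G v p w e" "j \<le> p" for p w e j
  proof (cases j)
    case (Suc i)
    then have "e i \<in> edges G" "w j \<in> ends G (e i)" using that by (auto simp: open_path_def)
    then show ?thesis using en by blast
  qed (use that v in \<open>simp add: open_path_def\<close>)
  have bound: "p < card (verts G)" if "open_path G v p w e" for p w e
  proof -
    have "card (w ` {..p}) \<le> card (verts G)"
      using wV[OF that] finV by (intro card_mono) auto
    then show ?thesis using that by (simp add: open_path_def card_image)
  qed
  have "open_path G v 0 (\<lambda>_. v) (\<lambda>_. undefined)" by (simp add: open_path_def)
  then have "\<exists>p. (\<exists>w e. open_path G v p w e) \<and> (\<forall>p'. (\<exists>w e. open_path G v p' w e) \<longrightarrow> p' \<le> p)"
    using bound by (intro Nat.ex_has_greatest_nat[of _ 0 "card (verts G)"]) (auto simp: less_imp_le)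
  then obtain p w e where P: "open_path G v p w e"
    and max: "\<And>p' w e. open_path G v p' w e \<Longrightarrow> p' \<le> p" by blast
  have w0: "w 0 = v" and wi: "inj_on w {..p}"
    and eE: "\<And>j. j < p \<Longrightarrow> e j \<in> edges G" and ee: "\<And>j. j < p \<Longrightarrow> ends G (e j) = {w j, w (Suc j)}"
    using P by (auto simp: open_path_def)
  have weq: "w i = w j \<longleftrightarrow> i = j" if "i \<le> p" "j \<le> p" for i j
    using wi that by (auto simp: inj_on_def)
  have ei: "e i = e j \<longleftrightarrow> i = j" if "i < p" "j < p" for i j
    using ee[OF that(1)] ee[OF that(2)] weq that by (auto simp: doubleton_eq_iff)
  have third: "f = g \<or> f = h \<or> g = h"
    if "f \<in> edges G" "g \<in> edges G" "h \<in> edges G" "u \<in> ends G f" "u \<in> ends G g" "u \<in> ends G h" for f g h u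
  proof (rule ccontr)
    assume "\<not> ?thesis"
    then have "card {f, g, h} = 3" by auto
    moreover have "card {f, g, h} \<le> card {f \<in> edges G. u \<in> ends G f}"
      using finE that by (intro card_mono) auto
    ultimately show False using deg[of u] en that by (simp add: subset_iff)
  qed
  obtain f where f: "f \<in> edges G" "w p \<in> ends G f" "p > 0 \<Longrightarrow> f \<noteq> e (p - 1)"
  proof -
    obtain a b where ab: "{f \<in> edges G. w p \<in> ends G f} = {a, b}" "a \<noteq> b"
      using deg[OF wV[OF P order.refl]] by (auto simp: card_2_iff)
    then show ?thesis using that[of a] that[of b] by blast
  qed
  obtain x where x: "ends G f = {w p, x}" "x \<noteq> w p"
  proof -
    obtain a b where "ends G f = {a, b}" "a \<noteq> b" using en[OF f(1)] by (auto simp: card_2_iff)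
    then show ?thesis using that f(2) by auto
  qed
  have "x \<in> w ` {..p}"
  proof (rule ccontr)
    assume nx: "x \<notin> w ` {..p}"
    have "inj_on (w(Suc p := x)) (insert (Suc p) {..p})"
      using wi nx by (subst inj_on_insert) (auto simp: inj_on_def)
    then have "open_path G v (Suc p) (w(Suc p := x)) (e(p := f))"
      using w0 eE ee f(1) x(1) by (auto simp: open_path_def less_Suc_eq atMost_Suc)
    then show False using max by fastforce
  qed
  then obtain i where i: "i \<le> p" "x = w i" by auto
  have ip: "i < p" using i x(2) by (cases "i = p") auto
  \<comment> \<open>A chord from the last vertex to an inner vertex would give the latter degree 3.\<close>
  have "i = 0"
  proof (rule ccontr)
    assume i0: "i \<noteq> 0"
    have "f = e (i - 1) \<or> f = e i \<or> e (i - 1) = e i"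
      using i0 ip f(1) x(1) eE ee[of i] ee[of "i - 1"] i(2)
      by (intro third[where u = "w i"]) auto
    moreover have "e (i - 1) \<noteq> e i" using ei[of "i - 1" i] i0 ip by auto
    moreover have "f \<noteq> e (i - 1)"
    proof
      assume "f = e (i - 1)"
      then have "w p \<in> {w (i - 1), w i}" using f(2) ee[of "i - 1"] ip i0 by auto
      then show False using weq ip by auto
    qed
    moreover have "f \<noteq> e i"
    proof
      assume fe: "f = e i"
      then have "w p \<in> {w i, w (Suc i)}" using f(2) ee[of i] ip by auto
      then have "p = Suc i" using weq[of p i] weq[of p "Suc i"] ip by auto
      then show False using f(3) fe by simp
    qed
    ultimately show False by blast
  qed
  then have p0: "p > 0" and xv: "x = w 0" using ip i by auto
  have fne: "f \<noteq> e j" if "j < p" for j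
  proof
    assume fe: "f = e j"
    then have "{w p, w 0} = {w j, w (Suc j)}" using x(1) xv ee[OF that] by simp
    then have "p = Suc j" using weq[of p j] weq[of p "Suc j"] that by (auto simp: doubleton_eq_iff)
    then show False using f(3) fe by simp
  qed
  define e' where "e' = e(p := f)"
  let ?c = "Suc p"
  have e'E: "e' j \<in> edges G" and e'e: "ends G (e' j) = {w j, w (Suc j mod ?c)}" if "j < ?c" for j
  proof -
    consider "j < p" "Suc j mod ?c = Suc j" | "j = p"
      using \<open>j < ?c\<close> mod_less[of "Suc j" ?c] by linarith
    then have "e' j \<in> edges G \<and> ends G (e' j) = {w j, w (Suc j mod ?c)}"
      using eE ee f(1) x(1) xv by cases (auto simp: e'_def)
    then show "e' j \<in> edges G" "ends G (e' j) = {w j, w (Suc j mod ?c)}" by auto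
  qed
  have e'i: "inj_on e' {..<?c}"
  proof (rule inj_onI)
    fix i j assume "i \<in> {..<?c}" "j \<in> {..<?c}" "e' i = e' j"
    then show "i = j" using ei[of i j] fne[of i] fne[of j]
      by (cases "i = p"; cases "j = p") (auto simp: e'_def)
  qed
  have incident: "g \<in> e' ` {..<?c}" if g: "g \<in> edges G" "w j \<in> ends G g" and j: "j \<le> p" for g j
  proof -
    define j' where "j' = (if j = 0 then p else j - 1)"
    have j': "j' \<noteq> j" "j' < ?c" "Suc j' mod ?c = j" using j p0 by (auto simp: j'_def)
    have "g = e' j' \<or> g = e' j \<or> e' j' = e' j"
      using g e'E[of j'] e'E[of j] e'e[of j'] e'e[of j] j j' by (intro third[where u = "w j"]) auto
    moreover have "e' j' \<noteq> e' j" using e'i j j' by (auto simp: inj_on_def)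
    ultimately show ?thesis using j j' by auto
  qed
  have wimg: "w ` {..p} = verts G"
  proof (rule connected_graph_closed[OF con])
    show "w ` {..p} \<subseteq> verts G" using wV[OF P] by auto
    show "w ` {..p} \<noteq> {}" by simp
    fix g assume g: "g \<in> edges G" "ends G g \<inter> w ` {..p} \<noteq> {}"
    then obtain j where "j < ?c" "g = e' j" using incident by fastforce
    moreover have "Suc j mod ?c \<le> p" by (simp add: less_Suc_eq_le[symmetric])
    ultimately show "ends G g \<subseteq> w ` {..p}" using e'e by auto
  qed
  have "edges G \<subseteq> e' ` {..<?c}"
  proof
    fix g assume g: "g \<in> edges G"
    then obtain u where "u \<in> ends G g" "u \<in> verts G" using en[OF g]
      by (metis card.empty equals0I subsetD zero_neq_numeral)
    then show "g \<in> e' ` {..<?c}" using incident[OF g] by (auto simp: wimg[symmetric])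
  qed
  then have e'img: "e' ` {..<?c} = edges G" using e'E by auto
  then have "c = ?c" using cE card_image[OF e'i] by simp
  moreover have "bij_betw w {..<?c} (verts G)"
    using wi wimg by (simp add: bij_betw_def lessThan_Suc_atMost)
  moreover have "bij_betw e' {..<?c} (edges G)" using e'i e'img by (simp add: bij_betw_def)
  ultimately show ?thesis using w0 e'e by blast
qed

text \<open>The converse of the previous lemma, for several cycles at once: \<open>Z j\<close> is the cyclic sequence of
  vertices of the \<open>j\<close>-th cycle. Only the vertices are enumerated: for the edges it is enough to
  know where they run, as 2-regularity determines their number by counting degrees.\<close>

lemma cyclic_families_decompose:
  fixes F :: "('v, 'e) mgraph" and Z :: "'j \<Rightarrow> nat \<Rightarrow> 'v"
  assumes mg: "multigraph F" and reg: "regular 2 F"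
    and len: "\<And>j. j \<in> J \<Longrightarrow> L j \<ge> 2"
    and bij: "bij_betw (\<lambda>(j, i). Z j i) (Sigma J (\<lambda>j. {..<L j})) (verts F)"
    and ex: "\<And>j i. j \<in> J \<Longrightarrow> i < L j \<Longrightarrow> \<exists>f\<in>edges F. ends F f = {Z j i, Z j (Suc i mod L j)}"
    and all: "\<And>f. f \<in> edges F \<Longrightarrow> \<exists>j\<in>J. \<exists>i<L j. ends F f = {Z j i, Z j (Suc i mod L j)}"
  shows "\<exists>D. vertex_disjoint_union F J D \<and> (\<forall>j\<in>J. is_cycle (L j) (D j))"
proof -
  define S where "S j = Z j ` {..<L j}" for j
  define D where "D j = \<lparr>verts = S j, edges = {f \<in> edges F. ends F f \<subseteq> S j}, ends = ends F\<rparr>" for j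
  have inj: "Z j i = Z j' i' \<longleftrightarrow> j = j' \<and> i = i'"
    if "j \<in> J" "j' \<in> J" "i < L j" "i' < L j'" for j j' i i'
    using bij_betw_imp_inj_on[OF bij] that by (fastforce simp: inj_on_def)
  have verts: "verts F = (\<Union>j\<in>J. S j)"
    using bij_betw_imp_surj_on[OF bij] by (fastforce simp: S_def)
  have disj: "S j \<inter> S j' = {}" if "j \<in> J" "j' \<in> J" "j \<noteq> j'" for j j'
    using that inj by (fastforce simp: S_def)
  have suc: "Suc i mod L j < L j" if "j \<in> J" for i j using len[OF that] by simp
  have closed: "\<exists>j\<in>J. ends F f \<subseteq> S j" if "f \<in> edges F" for f
    using all[OF that] suc by (fastforce simp: S_def)
  have fin: "finite (verts F)" "finite (edges F)"
    and en: "\<And>e. e \<in> edges F \<Longrightarrow> ends F e \<subseteq> verts F \<and> card (ends F e) = 2"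
    using mg by (auto simp: multigraph_def)
  have mgD: "multigraph (D j)" if "j \<in> J" for j
    using fin en that by (auto simp: multigraph_def D_def S_def)
  have regD: "regular 2 (D j)" if j: "j \<in> J" for j
    unfolding regular_def
  proof
    fix v assume v: "v \<in> verts (D j)"
    then have vS: "v \<in> S j" by (simp add: D_def)
    have "{f \<in> edges (D j). v \<in> ends (D j) f} = {f \<in> edges F. v \<in> ends F f}"
    proof -
      have "ends F f \<subseteq> S j" if f: "f \<in> edges F" "v \<in> ends F f" for f
      proof -
        obtain j' where "j' \<in> J" "ends F f \<subseteq> S j'" using closed f by blast
        then show ?thesis using disj[OF j, of j'] vS f by blast
      qed
      then show ?thesis by (auto simp: D_def)
    qed
    then show "degree (D j) v = 2"
      using reg vS verts j by (auto simp: regular_def degree_def)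
  qed
  have cyc: "is_cycle (L j) (D j)" if j: "j \<in> J" for j
  proof -
    have "inj_on (Z j) {..<L j}" using inj j by (auto simp: inj_on_def)
    then have "card (verts (D j)) = L j" by (simp add: D_def S_def card_image)
    then have "card (edges (D j)) = L j" using card_edges_2_regular[OF mgD regD] j by simp
    moreover have "connected_graph (D j)"
    proof -
      have sym: "sym (adjacency (D j))" by (auto simp: sym_def adjacency_def insert_commute)
      have reach: "(Z j 0, Z j i) \<in> (adjacency (D j))\<^sup>*" if "i < L j" for i
        using that
      proof (induction i)
        case (Suc i)
        obtain f where "f \<in> edges F" "ends F f = {Z j i, Z j (Suc i)}" using ex[OF j, of i] Suc by auto
        then have "(Z j i, Z j (Suc i)) \<in> adjacency (D j)"
          using Suc.prems by (auto simp: adjacency_def D_def S_def intro!: exI[of _ f])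
        then show ?case using Suc by (meson Suc_lessD rtrancl.rtrancl_into_rtrancl)
      qed simp
      have "(Z j i, Z j i') \<in> (adjacency (D j))\<^sup>*" if "i < L j" "i' < L j" for i i'
        using reach[OF that(1)] reach[OF that(2)] sym by (meson rtrancl_trans sym_rtrancl symD)
      moreover have "verts (D j) \<noteq> {}" using len[OF j] by (simp add: D_def S_def lessThan_empty_iff)
      ultimately show ?thesis by (auto simp: connected_graph_def D_def S_def)
    qed
    ultimately show ?thesis using len mgD regD j by (simp add: is_cycle_def)
  qed
  have "vertex_disjoint_union F J D"
    using mg mgD closed disj verts
    by (auto simp: vertex_disjoint_union_def subgraph_def D_def disjoint_family_on_def)
  then show ?thesis using cyc by blast
qed

section \<open>Coverings of multigraphs by perfect matchings\<close>

text \<open>\<open>H\<close> is an \<open>m\<close>-fold covering of \<open>G\<close> with the first projection as covering map: \<open>\<Phi> e\<close> is the set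
  of edges over \<open>e\<close>. The last condition makes \<open>\<Phi> e\<close> a perfect matching between the fibres of the two
  ends of \<open>e\<close>, without having to orient \<open>e\<close>.\<close>

definition covering ::
    "('v, 'e) mgraph \<Rightarrow> nat \<Rightarrow> ('v \<times> nat, 'f) mgraph \<Rightarrow> ('e \<Rightarrow> 'f set) \<Rightarrow> bool" where
  "covering G m H \<Phi> \<longleftrightarrow> multigraph G \<and> multigraph H \<and> verts H = verts G \<times> {..<m} \<and>
     edges H = (\<Union>e\<in>edges G. \<Phi> e) \<and> disjoint_family_on \<Phi> (edges G) \<and>
     (\<forall>e\<in>edges G. \<forall>f\<in>\<Phi> e. fst ` ends H f = ends G e) \<and>
     (\<forall>e\<in>edges G. \<forall>u\<in>ends G e. \<forall>x<m. \<exists>!f. f \<in> \<Phi> e \<and> (u, x) \<in> ends H f)"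

definition lift ::
    "nat \<Rightarrow> ('v \<times> nat, 'f) mgraph \<Rightarrow> ('e \<Rightarrow> 'f set) \<Rightarrow> ('v, 'e) mgraph \<Rightarrow> ('v \<times> nat, 'f) mgraph" where
  "lift m H \<Phi> S = \<lparr>verts = verts S \<times> {..<m}, edges = (\<Union>e\<in>edges S. \<Phi> e), ends = ends H\<rparr>"

text \<open>The edges of \<open>M\<close> run from \<open>(u, x)\<close> to \<open>(v, \<rho> x)\<close>: orienting an edge from \<open>u\<close> to \<open>v\<close> turns the
  matching over it into a function. The map \<open>en\<close> gives the ends of edges.\<close>

definition matching_along ::
    "('f \<Rightarrow> ('v \<times> nat) set) \<Rightarrow> 'f set \<Rightarrow> nat \<Rightarrow> 'v \<Rightarrow> 'v \<Rightarrow> (nat \<Rightarrow> nat) \<Rightarrow> bool" where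
  "matching_along en M m u v \<rho> \<longleftrightarrow>
     (\<forall>x<m. \<exists>f\<in>M. en f = {(u, x), (v, \<rho> x)}) \<and> (\<forall>f\<in>M. \<exists>x<m. en f = {(u, x), (v, \<rho> x)})"

lemma covering_disjoint:
  assumes "covering G m H \<Phi>" "e \<in> edges G" "e' \<in> edges G" "f \<in> \<Phi> e" "f \<in> \<Phi> e'"
  shows "e = e'"
proof (rule ccontr)
  assume "e \<noteq> e'"
  moreover have "disjoint_family_on \<Phi> (edges G)" using assms(1) by (simp add: covering_def)
  ultimately have "\<Phi> e \<inter> \<Phi> e' = {}" using assms(2,3) by (simp add: disjoint_family_on_def)
  then show False using assms(4,5) by blast
qed

lemma covering_unique:
  assumes "covering G m H \<Phi>" "e \<in> edges G" "u \<in> ends G e" "x < m"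
  shows "\<exists>!f. f \<in> \<Phi> e \<and> (u, x) \<in> ends H f"
  using assms unfolding covering_def by blast

lemma subgraph_lift:
  assumes "covering G m H \<Phi>" "subgraph S G"
  shows "subgraph (lift m H \<Phi> S) H"
proof -
  have H: "multigraph H" "verts H = verts G \<times> {..<m}" "edges H = (\<Union>e\<in>edges G. \<Phi> e)"
    and pr: "\<And>e f. e \<in> edges G \<Longrightarrow> f \<in> \<Phi> e \<Longrightarrow> fst ` ends H f = ends G e"
    using assms(1) by (auto simp: covering_def)
  have S: "multigraph S" "verts S \<subseteq> verts G" "edges S \<subseteq> edges G"
    "\<And>e. e \<in> edges S \<Longrightarrow> ends S e = ends G e"
    using assms(2) by (auto simp: subgraph_def)
  have sub: "(\<Union>e\<in>edges S. \<Phi> e) \<subseteq> edges H" using H(3) S(3) by blast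
  have "ends H f \<subseteq> verts S \<times> {..<m}" if "e \<in> edges S" "f \<in> \<Phi> e" for e f
  proof -
    have "fst ` ends H f = ends S e" using pr[of e f] S that by auto
    then have "fst ` ends H f \<subseteq> verts S" using S(1) that by (auto simp: multigraph_def)
    moreover have "ends H f \<subseteq> verts G \<times> {..<m}"
    proof -
      have "f \<in> edges H" using that sub by blast
      then show ?thesis using H(1,2) by (simp add: multigraph_def)
    qed
    ultimately show ?thesis by fastforce
  qed
  moreover have "finite (\<Union>e\<in>edges S. \<Phi> e)"
    using sub H(1) by (auto simp: multigraph_def intro: finite_subset)
  ultimately have "multigraph (lift m H \<Phi> S)"
    using H(1) S(1) sub unfolding multigraph_def lift_def by auto
  then show ?thesis using H S sub by (auto simp: subgraph_def lift_def)
qed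

text \<open>Every edge at \<open>u\<close> has exactly one edge over it at \<open>(u, x)\<close>.\<close>

lemma degree_lift:
  assumes cov: "covering G m H \<Phi>" and S: "subgraph S G" and x: "x < m"
  shows "degree (lift m H \<Phi> S) (u, x) = degree S u"
proof -
  let ?E = "{e \<in> edges S. u \<in> ends S e}"
  have E: "e \<in> edges G" "ends S e = ends G e" if "e \<in> edges S" for e
    using S that by (auto simp: subgraph_def)
  have pr: "\<And>e f. e \<in> edges G \<Longrightarrow> f \<in> \<Phi> e \<Longrightarrow> fst ` ends H f = ends G e"
    using cov by (auto simp: covering_def)
  have "\<forall>e\<in>?E. \<exists>!f. f \<in> \<Phi> e \<and> (u, x) \<in> ends H f"
    using covering_unique[OF cov _ _ x] E by blast
  then obtain g where g: "\<And>e. e \<in> ?E \<Longrightarrow> g e \<in> \<Phi> e \<and> (u, x) \<in> ends H (g e)"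
    "\<And>e f. e \<in> ?E \<Longrightarrow> f \<in> \<Phi> e \<Longrightarrow> (u, x) \<in> ends H f \<Longrightarrow> f = g e"
    by (metis (no_types, lifting))
  have "{f \<in> edges (lift m H \<Phi> S). (u, x) \<in> ends (lift m H \<Phi> S) f} = g ` ?E"
  proof (intro equalityI subsetI)
    fix f assume "f \<in> {f \<in> edges (lift m H \<Phi> S). (u, x) \<in> ends (lift m H \<Phi> S) f}"
    then obtain e where e: "e \<in> edges S" "f \<in> \<Phi> e" "(u, x) \<in> ends H f" by (auto simp: lift_def)
    then have "u \<in> ends S e" using pr[of e f] E[of e] by force
    then show "f \<in> g ` ?E" using g(2)[of e f] e by auto
  qed (use g in \<open>auto simp: lift_def\<close>)
  moreover have "inj_on g ?E"
  proof (rule inj_onI)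
    fix e e' assume "e \<in> ?E" "e' \<in> ?E" "g e = g e'"
    then show "e = e'" using covering_disjoint[OF cov, of e e' "g e"] g(1)[of e] g(1)[of e'] E by auto
  qed
  ultimately show ?thesis by (simp add: degree_def card_image)
qed

lemma regular_lift:
  assumes "covering G m H \<Phi>" "subgraph S G" "regular d S"
  shows "regular d (lift m H \<Phi> S)"
  unfolding regular_def
proof
  fix z assume "z \<in> verts (lift m H \<Phi> S)"
  then obtain u x where "z = (u, x)" "u \<in> verts S" "x < m" by (auto simp: lift_def)
  then show "degree (lift m H \<Phi> S) z = d"
    using degree_lift[OF assms(1,2)] assms(3) by (simp add: regular_def)
qed

lemma card_edges_lift:
  assumes "covering G m H \<Phi>" "subgraph S G" "regular 2 S"
  shows "card (edges (lift m H \<Phi> S)) = card (edges S) * m"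
proof -
  have "multigraph (lift m H \<Phi> S)" "multigraph S"
    using subgraph_lift[OF assms(1,2)] assms(2) by (auto simp: subgraph_def)
  then show ?thesis
    using card_edges_2_regular[OF _ regular_lift[OF assms]] card_edges_2_regular[OF _ assms(3)]
    by (simp add: lift_def card_cartesian_product)
qed

lemma decomposition_lift:
  assumes cov: "covering G m H \<Phi>" and dec: "decomposition G A S"
  shows "decomposition H A (\<lambda>i. lift m H \<Phi> (S i))"
proof -
  have sub: "\<And>i. i \<in> A \<Longrightarrow> subgraph (S i) G" and un: "(\<Union>i\<in>A. edges (S i)) = edges G"
    and disj: "\<And>i j. i \<in> A \<Longrightarrow> j \<in> A \<Longrightarrow> i \<noteq> j \<Longrightarrow> edges (S i) \<inter> edges (S j) = {}"
    using dec by (auto simp: decomposition_def disjoint_family_on_def)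
  have eH: "edges H = (\<Union>e\<in>edges G. \<Phi> e)" using cov by (simp add: covering_def)
  have "disjoint_family_on (\<lambda>i. edges (lift m H \<Phi> (S i))) A"
    unfolding disjoint_family_on_def
  proof (intro ballI impI equals0I)
    fix i j f assume ij: "i \<in> A" "j \<in> A" "i \<noteq> j"
      and "f \<in> edges (lift m H \<Phi> (S i)) \<inter> edges (lift m H \<Phi> (S j))"
    then obtain e e' where "e \<in> edges (S i)" "f \<in> \<Phi> e" "e' \<in> edges (S j)" "f \<in> \<Phi> e'"
      by (auto simp: lift_def)
    then show False using covering_disjoint[OF cov, of e e' f] disj[OF ij] un ij by auto
  qed
  moreover have "(\<Union>i\<in>A. edges (lift m H \<Phi> (S i))) = edges H"
    unfolding eH un[symmetric] by (auto simp: lift_def)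
  ultimately show ?thesis using sub subgraph_lift[OF cov] by (simp add: decomposition_def)
qed

lemma decomposition_plus_one_factor_lift:
  assumes cov: "covering G m H \<Phi>" and dec: "decomposition_plus_one_factor G A S"
  shows "decomposition_plus_one_factor H A (\<lambda>i. lift m H \<Phi> (S i))"
proof -
  obtain J where J: "one_factor J G" and D: "decomposition G (insert None (Some ` A)) (case_option J S)"
    using dec by (auto simp: decomposition_plus_one_factor_def)
  have "one_factor (lift m H \<Phi> J) H"
    using J cov subgraph_lift[OF cov] regular_lift[OF cov]
    by (simp add: one_factor_def covering_def) (simp add: lift_def)
  moreover have "(\<lambda>i. lift m H \<Phi> (case_option J S i))
      = case_option (lift m H \<Phi> J) (\<lambda>i. lift m H \<Phi> (S i))"
    by (auto split: option.splits)
  ultimately show ?thesis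
    using decomposition_lift[OF cov D] by (auto simp: decomposition_plus_one_factor_def)
qed

lemma covering_matching:
  assumes cov: "covering G m H \<Phi>" and e: "e \<in> edges G" "ends G e = {u, v}" "u \<noteq> v"
  shows "\<exists>\<rho>. bij_betw \<rho> {..<m} {..<m} \<and> matching_along (ends H) (\<Phi> e) m u v \<rho>"
proof -
  have uniq: "\<exists>!f. f \<in> \<Phi> e \<and> (w, x) \<in> ends H f" if "w \<in> {u, v}" "x < m" for w x
    using covering_unique[OF cov e(1) _ that(2)] that(1) e(2) by simp
  have form: "\<exists>x<m. \<exists>y<m. ends H f = {(u, x), (v, y)}" if f: "f \<in> \<Phi> e" for f
  proof -
    have "f \<in> edges H" "fst ` ends H f = {u, v}" "verts H = verts G \<times> {..<m}" "multigraph H"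
      using cov e f by (auto simp: covering_def)
    moreover from this obtain a b where ab: "ends H f = {a, b}" "a \<in> verts H" "b \<in> verts H"
      by (auto simp: multigraph_def card_2_iff)
    ultimately have "snd a < m" "snd b < m" "{fst a, fst b} = {u, v}" by auto
    then have "snd a < m" "snd b < m" "a = (u, snd a) \<and> b = (v, snd b) \<or> a = (v, snd a) \<and> b = (u, snd b)"
      using e(3) by (auto simp: doubleton_eq_iff prod_eq_iff)
    then show ?thesis
    proof (elim disjE)
      assume "a = (v, snd a) \<and> b = (u, snd b)"
      then have "ends H f = {(u, snd b), (v, snd a)}" using ab(1) by auto
      then show ?thesis using \<open>snd a < m\<close> \<open>snd b < m\<close> by blast
    qed (use ab(1) \<open>snd a < m\<close> \<open>snd b < m\<close> in metis)
  qed
  have "\<exists>y<m. \<exists>f\<in>\<Phi> e. ends H f = {(u, x), (v, y)}" if x: "x < m" for x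
  proof -
    obtain f where f: "f \<in> \<Phi> e" "(u, x) \<in> ends H f" using uniq[of u x] x by auto
    obtain x' y where xy: "y < m" "ends H f = {(u, x'), (v, y)}" using form[OF f(1)] by blast
    then have "x' = x" using f(2) e(3) by auto
    then show ?thesis using xy f(1) by blast
  qed
  then obtain \<rho> where \<rho>: "\<And>x. x < m \<Longrightarrow> \<rho> x < m \<and> (\<exists>f\<in>\<Phi> e. ends H f = {(u, x), (v, \<rho> x)})"
    by metis
  have all: "\<exists>x<m. ends H f = {(u, x), (v, \<rho> x)}" if f: "f \<in> \<Phi> e" for f
  proof -
    obtain x y where xy: "x < m" "ends H f = {(u, x), (v, y)}" using form[OF f] by blast
    obtain g where g: "g \<in> \<Phi> e" "ends H g = {(u, x), (v, \<rho> x)}" using \<rho>[OF xy(1)] by blast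
    have "f = g" using uniq[of u x] xy f g by auto
    then show ?thesis using xy(1) g by blast
  qed
  have "inj_on \<rho> {..<m}"
  proof (rule inj_onI)
    fix x x' assume x: "x \<in> {..<m}" "x' \<in> {..<m}" "\<rho> x = \<rho> x'"
    obtain f where f: "f \<in> \<Phi> e" "ends H f = {(u, x), (v, \<rho> x)}" using \<rho>[of x] x by auto
    obtain g where g: "g \<in> \<Phi> e" "ends H g = {(u, x'), (v, \<rho> x)}" using \<rho>[of x'] x by auto
    have "f = g" using uniq[of v "\<rho> x"] \<rho>[of x] x f g by auto
    then show "x = x'" using f g e(3) by (auto simp: doubleton_eq_iff)
  qed
  moreover have "\<rho> ` {..<m} = {..<m}" using \<rho> calculation by (intro endo_inj_surj) auto
  ultimately show ?thesis using \<rho> all by (auto simp: bij_betw_def matching_along_def)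
qed

text \<open>The monodromy argument. The permutation \<open>\<theta> l\<close> transports the fibre of \<open>w 0\<close> to that of \<open>w l\<close> along
  the cycle, so the lift of the path \<open>w 0, \<dots>, w (c - 1)\<close> consists of \<open>m\<close> disjoint paths, one for each
  element of the fibre of \<open>w 0\<close>. The last edge joins the end of the path of \<open>x\<close> to the start of
  the path of \<open>\<sigma> x\<close>, where \<open>\<sigma>\<close> is the monodromy. Here \<open>\<sigma>\<close> permutes cyclically each block
  \<open>b j 0, \<dots>, b j (q j - 1)\<close>, so the \<open>q j\<close> paths of a block close up to one cycle.\<close>

lemma lift_of_cycle:
  assumes cov: "covering G m H \<Phi>" and sub: "subgraph S G" and reg: "regular 2 S" and c: "c \<ge> 2"
    and w: "bij_betw w {..<c} (verts S)" and e: "bij_betw e {..<c} (edges S)"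
    and match: "\<And>l. l < c \<Longrightarrow> matching_along (ends H) (\<Phi> (e l)) m (w l) (w (Suc l mod c)) (\<rho> l)"
    and \<theta>: "\<And>l. l < c \<Longrightarrow> bij_betw (\<theta> l) {..<m} {..<m}"
    and \<theta>0: "\<And>x. x < m \<Longrightarrow> \<theta> 0 x = x"
    and \<theta>Suc: "\<And>l x. Suc l < c \<Longrightarrow> x < m \<Longrightarrow> \<rho> l (\<theta> l x) = \<theta> (Suc l) x"
    and q: "\<And>j. j \<in> J \<Longrightarrow> q j > 0"
    and b: "bij_betw (\<lambda>(j, y). b j y) (Sigma J (\<lambda>j. {..<q j})) {..<m}"
    and mono: "\<And>j y. j \<in> J \<Longrightarrow> y < q j \<Longrightarrow> \<rho> (c - 1) (\<theta> (c - 1) (b j y)) = b j (Suc y mod q j)"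
  shows "\<exists>D. vertex_disjoint_union (lift m H \<Phi> S) J D \<and> (\<forall>j\<in>J. is_cycle (q j * c) (D j))"
proof -
  let ?F = "lift m H \<Phi> S"
  \<comment> \<open>The \<open>i\<close>-th vertex of the \<open>j\<close>-th cycle, which runs through \<open>c\<close> vertices for each element of the
    block.\<close>
  define Z where "Z j i = (w (i mod c), \<theta> (i mod c) (b j (i div c)))" for j i
  have bm: "b j y < m" if "j \<in> J" "y < q j" for j y
    using bij_betw_imp_surj_on[OF b] that by fastforce
  have binj: "j = j' \<and> y = y'" if "b j y = b j' y'" "j \<in> J" "y < q j" "j' \<in> J" "y' < q j'" for j y j' y'
    using bij_betw_imp_inj_on[OF b] that by (fastforce simp: inj_on_def)
  have bsurj: "\<exists>j\<in>J. \<exists>y<q j. x = b j y" if "x < m" for x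
  proof -
    have "x \<in> (\<lambda>(j, y). b j y) ` Sigma J (\<lambda>j. {..<q j})"
      using bij_betw_imp_surj_on[OF b] that by simp
    then show ?thesis by auto
  qed
  have div: "i div c < q j" if "i < q j * c" for i j using that by (simp add: less_mult_imp_div_less)
  have mod: "i mod c < c" for i using c by simp
  have idx: "y * c + l < q j * c" if "y < q j" "l < c" for y l j
  proof -
    have "y * c + l < Suc y * c" using that by simp
    also have "\<dots> \<le> q j * c" using that by (intro mult_le_mono1) simp
    finally show ?thesis .
  qed
  have \<theta>m: "\<theta> l x < m" if "l < c" "x < m" for l x
    using bij_betw_imp_surj_on[OF \<theta>[OF that(1)]] that(2) by auto
  have \<theta>inj: "x = y" if "\<theta> l x = \<theta> l y" "l < c" "x < m" "y < m" for l x y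
    using bij_betw_imp_inj_on[OF \<theta>[OF that(2)]] that by (auto simp: inj_on_def)
  have \<theta>surj: "\<exists>x'<m. x = \<theta> l x'" if "l < c" "x < m" for l x
  proof -
    have "x \<in> \<theta> l ` {..<m}" using bij_betw_imp_surj_on[OF \<theta>[OF that(1)]] that(2) by simp
    then show ?thesis by auto
  qed
  have wV: "w ` {..<c} = verts S" using w by (simp add: bij_betw_def)
  have bij: "bij_betw (\<lambda>(j, i). Z j i) (Sigma J (\<lambda>j. {..<q j * c})) (verts ?F)"
    unfolding bij_betw_def
  proof (intro conjI inj_onI equalityI subsetI)
    fix s s' assume s: "s \<in> Sigma J (\<lambda>j. {..<q j * c})" "s' \<in> Sigma J (\<lambda>j. {..<q j * c})"
      "(case s of (j, i) \<Rightarrow> Z j i) = (case s' of (j, i) \<Rightarrow> Z j i)"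
    obtain j i j' i' where ss: "s = (j, i)" "s' = (j', i')" by (metis surj_pair)
    have ji: "j \<in> J" "i < q j * c" "j' \<in> J" "i' < q j' * c" using s ss by auto
    have "w (i mod c) = w (i' mod c)"
      and eq: "\<theta> (i mod c) (b j (i div c)) = \<theta> (i' mod c) (b j' (i' div c))"
      using s(3) ss by (auto simp: Z_def)
    then have mm: "i mod c = i' mod c"
      using bij_betw_imp_inj_on[OF w] mod by (auto simp: inj_on_def)
    then have "b j (i div c) = b j' (i' div c)"
      using \<theta>inj[OF _ mod bm[OF ji(1) div[OF ji(2)]] bm[OF ji(3) div[OF ji(4)]]] eq by simp
    then have "j = j' \<and> i div c = i' div c"
      by (rule binj[OF _ ji(1) div[OF ji(2)] ji(3) div[OF ji(4)]])
    then show "s = s'" using mm ss by (metis div_mult_mod_eq)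
  next
    fix z assume "z \<in> (\<lambda>(j, i). Z j i) ` Sigma J (\<lambda>j. {..<q j * c})"
    then obtain j i where "j \<in> J" "i < q j * c" "z = Z j i" by auto
    then show "z \<in> verts ?F"
      using wV mod by (auto simp: lift_def Z_def intro!: \<theta>m bm div)
  next
    fix z assume "z \<in> verts ?F"
    then obtain u x where z: "z = (u, x)" "u \<in> verts S" "x < m" by (auto simp: lift_def)
    then obtain l where l: "l < c" "u = w l" using wV by auto
    obtain x' where x': "x' < m" "x = \<theta> l x'" using \<theta>surj[OF l(1) z(3)] by blast
    obtain j y where jy: "j \<in> J" "y < q j" "x' = b j y" using bsurj[OF x'(1)] by blast
    have "z = Z j (y * c + l)" using z l x' jy by (simp add: Z_def)
    then show "z \<in> (\<lambda>(j, i). Z j i) ` Sigma J (\<lambda>j. {..<q j * c})"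
      using idx[OF jy(2) l(1)] jy(1) by (auto intro!: image_eqI[of _ _ "(j, y * c + l)"])
  qed
  have step: "Z j (Suc i mod (q j * c)) = (w (Suc (i mod c) mod c), \<rho> (i mod c) (\<theta> (i mod c) (b j (i div c))))"
    if j: "j \<in> J" and i: "i < q j * c" for j i
  proof (cases "Suc (i mod c) = c")
    case False
    then have l: "Suc (i mod c) < c" using mod[of i] by simp
    then have m1: "Suc i mod c = Suc (i mod c)" "Suc i div c = i div c"
      by (simp_all add: mod_Suc div_Suc)
    have "Suc i < q j * c"
    proof -
      have "Suc i = (i div c) * c + Suc (i mod c)" by simp
      then show ?thesis using idx[OF div[OF i] l] by argo
    qed
    then show ?thesis using m1 l \<theta>Suc[OF l bm[OF j div[OF i]]] by (simp add: Z_def)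
  next
    case True
    have "Suc i = i div c * c + Suc (i mod c)" by simp
    then have "Suc i = Suc (i div c) * c" using True by simp
    then have "Suc i mod (q j * c) = (Suc (i div c) mod q j) * c" by (metis mod_mult_mult2)
    then have "Z j (Suc i mod (q j * c)) = (w 0, b j (Suc (i div c) mod q j))"
      using c \<theta>0 bm j q by (simp add: Z_def)
    moreover have "i mod c = c - 1" using True by simp
    ultimately show ?thesis using mono[OF j div[OF i]] c by simp
  qed
  have eE: "e l \<in> edges S" if "l < c" for l using e that by (auto simp: bij_betw_def)
  show ?thesis
  proof (rule cyclic_families_decompose[OF _ regular_lift[OF cov sub reg] _ bij])
    show "multigraph ?F" using subgraph_lift[OF cov sub] by (simp add: subgraph_def)
    show "2 \<le> q j * c" if "j \<in> J" for j using q[OF that] c by (metis mult_le_mono One_nat_def Suc_leI mult_1)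
    show "\<exists>f\<in>edges ?F. ends ?F f = {Z j i, Z j (Suc i mod (q j * c))}" if ji: "j \<in> J" "i < q j * c" for j i
    proof -
      have "\<theta> (i mod c) (b j (i div c)) < m" using ji by (auto intro!: \<theta>m bm div mod)
      then obtain f where "f \<in> \<Phi> (e (i mod c))" "ends H f = {Z j i, Z j (Suc i mod (q j * c))}"
        using match[OF mod[of i]] step[OF ji] unfolding matching_along_def Z_def[of j i] by auto
      then show ?thesis using eE[OF mod[of i]] by (auto simp: lift_def)
    qed
    fix f assume "f \<in> edges ?F"
    then obtain l where l: "l < c" "f \<in> \<Phi> (e l)"
      using bij_betw_imp_surj_on[OF e, symmetric] by (auto simp: lift_def)
    then obtain x where x: "x < m" "ends H f = {(w l, x), (w (Suc l mod c), \<rho> l x)}"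
      using match[OF l(1)] unfolding matching_along_def by blast
    obtain x' where x': "x' < m" "x = \<theta> l x'" using \<theta>surj[OF l(1) x(1)] by blast
    obtain j y where jy: "j \<in> J" "y < q j" "x' = b j y" using bsurj[OF x'(1)] by blast
    have "ends H f = {Z j (y * c + l), Z j (Suc (y * c + l) mod (q j * c))}"
      using step[OF jy(1) idx[OF jy(2) l(1)]] x x' jy l by (simp add: Z_def)
    then show "\<exists>j\<in>J. \<exists>i<q j * c. ends ?F f = {Z j i, Z j (Suc i mod (q j * c))}"
      using jy(1) idx[OF jy(2) l(1)] by (auto simp: lift_def)
  qed
qed

section \<open>Matchings between two parts\<close>

text \<open>\<open>\<Psi>\<close> splits the edges of \<open>\<lambda>K\<^sub>n\<^sub>\<times>\<^sub>m\<close> between the two parts that belong to the vertices in \<open>p\<close> into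
  \<open>\<lambda>m\<close> perfect matchings. The edge \<open>(A, s)\<close> is the \<open>s\<close>-th parallel copy of the edge with ends \<open>A\<close>.\<close>

definition pair_lift :: "nat \<Rightarrow> nat \<Rightarrow> 'v set \<Rightarrow> (nat \<Rightarrow> (('v \<times> nat) set \<times> nat) set) \<Rightarrow> bool" where
  "pair_lift lam m p \<Psi> \<longleftrightarrow>
     disjoint_family_on \<Psi> {..<lam * m} \<and>
     (\<Union>t<lam * m. \<Psi> t) = {(A, s). card A = 2 \<and> fst ` A = p \<and> snd ` A \<subseteq> {..<m} \<and> s < lam} \<and>
     (\<forall>t<lam * m. \<forall>u\<in>p. \<forall>x<m. \<exists>!f. f \<in> \<Psi> t \<and> (u, x) \<in> fst f)"

text \<open>The completed Latin rectangle gives the matchings up to the choice of copies. As each pair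
  \<open>(x, y)\<close> occurs in exactly \<open>lam\<close> of the permutations, the \<open>lam\<close> parallel edges between \<open>(u, x)\<close> and
  \<open>(v, y)\<close> can be distributed bijectively among these (this is \<open>\<kappa> x y\<close>).\<close>

lemma pair_lift_exists:
  assumes uv: "u \<noteq> v" and T: "T \<subseteq> {..<lam * m}"
    and \<tau>: "\<And>t. t \<in> T \<Longrightarrow> bij_betw (\<tau> t) {..<m} {..<m}"
    and le: "\<And>x y. x < m \<Longrightarrow> y < m \<Longrightarrow> card {t \<in> T. \<tau> t x = y} \<le> lam"
  shows "\<exists>\<Psi>. pair_lift lam m {u, v} \<Psi> \<and> (\<forall>t\<in>T. matching_along fst (\<Psi> t) m u v (\<tau> t))"
proof -
  obtain \<pi> where \<pi>T: "\<And>t. t \<in> T \<Longrightarrow> \<pi> t = \<tau> t"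
    and bij: "\<And>t. t < lam * m \<Longrightarrow> bij_betw (\<pi> t) {..<m} {..<m}"
    and cnt: "\<And>x y. x < m \<Longrightarrow> y < m \<Longrightarrow> card {t. t < lam * m \<and> \<pi> t x = y} = lam"
    using latin_rectangle_completion[OF T \<tau> le] by blast
  have "\<exists>k. bij_betw k {t. t < lam * m \<and> \<pi> t x = y} {..<lam}" if "x < m" "y < m" for x y
    using cnt[OF that] by (intro finite_same_card_bij) auto
  then obtain \<kappa> where \<kappa>: "\<And>x y. x < m \<Longrightarrow> y < m \<Longrightarrow>
      bij_betw (\<kappa> x y) {t. t < lam * m \<and> \<pi> t x = y} {..<lam}" by metis
  have \<pi>m: "\<pi> t x < m" if "t < lam * m" "x < m" for t x
    using bij_betw_imp_surj_on[OF bij[OF that(1)]] that(2) by auto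
  define \<Psi> where "\<Psi> t = (\<lambda>x. ({(u, x), (v, \<pi> t x)}, \<kappa> x (\<pi> t x) t)) ` {..<m}" for t
  have eq: "{(u, x), (v, y)} = {(u, x'), (v, y')} \<longleftrightarrow> x = x' \<and> y = y'" for x y x' y' :: nat
    using uv by (auto simp: doubleton_eq_iff)
  have disj: "t = t'" if t: "t < lam * m" "t' < lam * m" and f: "f \<in> \<Psi> t" "f \<in> \<Psi> t'" for t t' f
  proof -
    obtain x where x: "x < m" "f = ({(u, x), (v, \<pi> t x)}, \<kappa> x (\<pi> t x) t)"
      using f(1) by (auto simp: \<Psi>_def)
    obtain x' where x': "x' < m" "f = ({(u, x'), (v, \<pi> t' x')}, \<kappa> x' (\<pi> t' x') t')"
      using f(2) by (auto simp: \<Psi>_def)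
    have xx: "x' = x" "\<pi> t' x = \<pi> t x" using x x' eq by auto
    then have "\<kappa> x (\<pi> t x) t = \<kappa> x (\<pi> t x) t'" using x x' by simp
    then show ?thesis
      using bij_betw_imp_inj_on[OF \<kappa>[OF x(1) \<pi>m[OF t(1) x(1)]]] t xx by (auto simp: inj_on_def)
  qed
  have union: "(\<Union>t<lam * m. \<Psi> t)
      = {(A, s). card A = 2 \<and> fst ` A = {u, v} \<and> snd ` A \<subseteq> {..<m} \<and> s < lam}" (is "?L = ?R")
  proof (intro equalityI subsetI)
    fix f assume "f \<in> ?L"
    then obtain t x where tx: "t < lam * m" "x < m" "f = ({(u, x), (v, \<pi> t x)}, \<kappa> x (\<pi> t x) t)"
      by (auto simp: \<Psi>_def)
    moreover have "\<kappa> x (\<pi> t x) t < lam"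
      using bij_betw_imp_surj_on[OF \<kappa>[OF tx(2) \<pi>m[OF tx(1,2)]]] tx(1) by auto
    ultimately show "f \<in> ?R" using \<pi>m[OF tx(1,2)] uv by auto
  next
    fix f assume "f \<in> ?R"
    then obtain A s where f: "f = (A, s)" "card A = 2" "fst ` A = {u, v}" "snd ` A \<subseteq> {..<m}" "s < lam"
      by auto
    obtain a b where ab: "A = {a, b}" "a \<noteq> b" using f(2) by (auto simp: card_2_iff)
    have "\<exists>x y. x < m \<and> y < m \<and> A = {(u, x), (v, y)}"
    proof (cases "fst a = u")
      case True
      then have "fst a = u" "fst b = v" using f(3) ab uv by (auto simp: doubleton_eq_iff)
      then have "A = {(u, snd a), (v, snd b)}" using ab(1) by (cases a; cases b) simp
      moreover have "snd a < m" "snd b < m" using f(4) ab by auto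
      ultimately show ?thesis by blast
    next
      case False
      then have "fst a = v" "fst b = u" using f(3) ab uv by (auto simp: doubleton_eq_iff)
      then have "A = {(u, snd b), (v, snd a)}" using ab(1) by (cases a; cases b) auto
      moreover have "snd a < m" "snd b < m" using f(4) ab by auto
      ultimately show ?thesis by blast
    qed
    then obtain x y where xy: "x < m" "y < m" "A = {(u, x), (v, y)}" by blast
    have "s \<in> \<kappa> x y ` {t. t < lam * m \<and> \<pi> t x = y}"
      using bij_betw_imp_surj_on[OF \<kappa>[OF xy(1,2)]] f(5) by simp
    then obtain t where "t < lam * m" "\<pi> t x = y" "\<kappa> x y t = s" by auto
    then show "f \<in> ?L" using f(1) xy unfolding \<Psi>_def by auto
  qed
  have unique: "\<exists>!f. f \<in> \<Psi> t \<and> (z, x) \<in> fst f" if t: "t < lam * m" and z: "z \<in> {u, v}" "x < m" for t z x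
  proof (cases "z = u")
    case True
    then show ?thesis using z(2) uv
      by (intro ex1I[of _ "({(u, x), (v, \<pi> t x)}, \<kappa> x (\<pi> t x) t)"]) (auto simp: \<Psi>_def)
  next
    case False
    have "x \<in> \<pi> t ` {..<m}" using bij_betw_imp_surj_on[OF bij[OF t]] z(2) by simp
    then obtain y where y: "y < m" "x = \<pi> t y" by auto
    have "y' = y" if "y' < m" "x = \<pi> t y'" for y'
      using bij_betw_imp_inj_on[OF bij[OF t]] y that by (auto simp: inj_on_def)
    then show ?thesis using False z(1) y uv
      by (intro ex1I[of _ "({(u, y), (v, \<pi> t y)}, \<kappa> y (\<pi> t y) t)"]) (auto simp: \<Psi>_def)
  qed
  have "disjoint_family_on \<Psi> {..<lam * m}"
    unfolding disjoint_family_on_def using disj by (meson disjoint_iff lessThan_iff)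
  then have "pair_lift lam m {u, v} \<Psi>"
    unfolding pair_lift_def by (intro conjI union allI ballI impI unique)
  moreover have "matching_along fst (\<Psi> t) m u v (\<tau> t)" if "t \<in> T" for t
    using \<pi>T[OF that] by (auto simp: matching_along_def \<Psi>_def)
  ultimately show ?thesis by blast
qed

abbreviation (input) base :: "nat \<Rightarrow> nat \<Rightarrow> nat \<Rightarrow> (nat, nat set \<times> nat) mgraph" where
  "base lam m n \<equiv> multiple (lam * m) (complete_graph n)"

abbreviation (input) cover :: "nat \<Rightarrow> nat \<Rightarrow> nat \<Rightarrow> (nat \<times> nat, (nat \<times> nat) set \<times> nat) mgraph" where
  "cover lam m n \<equiv> multiple lam (complete_equipartite_graph n m)"

text \<open>The matchings for different pairs of parts can be chosen independently of each other, which is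
  what allows them to be revised one pair at a time.\<close>

lemma covering_of_pair_lifts:
  assumes \<Phi>: "\<And>p. p \<in> edges (complete_graph n) \<Longrightarrow> pair_lift lam m p (\<Phi> p)"
  shows "covering (base lam m n) m (cover lam m n) (\<lambda>(p, t). \<Phi> p t)"
proof -
  let ?E = "edges (complete_graph n)"
  have E: "?E = {{u, v} | u v. u < n \<and> v < n \<and> u \<noteq> v}" by (simp add: complete_graph_def)
  have un: "(\<Union>t<lam * m. \<Phi> p t)
      = {(A, s). card A = 2 \<and> fst ` A = p \<and> snd ` A \<subseteq> {..<m} \<and> s < lam}" if "p \<in> ?E" for p
    using \<Phi>[OF that] by (simp add: pair_lift_def)
  have pr: "fst ` fst f = p" if "p \<in> ?E" "t < lam * m" "f \<in> \<Phi> p t" for p t f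
  proof -
    have "f \<in> (\<Union>t<lam * m. \<Phi> p t)" using that(2,3) by blast
    then show ?thesis unfolding un[OF that(1)] by auto
  qed
  have edges: "edges (cover lam m n) = (\<Union>e\<in>?E \<times> {..<lam * m}. case e of (p, t) \<Rightarrow> \<Phi> p t)"
  proof -
    have "edges (complete_equipartite_graph n m)
        = {A. card A = 2 \<and> fst ` A \<in> ?E \<and> snd ` A \<subseteq> {..<m}}" (is "?L = ?R")
    proof (intro equalityI subsetI)
      fix A assume "A \<in> ?L"
      then obtain a b where ab: "A = {a, b}" "a \<in> {..<n} \<times> {..<m}" "b \<in> {..<n} \<times> {..<m}" "fst a \<noteq> fst b"
        by (auto simp: complete_equipartite_graph_def)
      then have "fst ` A \<in> ?E" unfolding E by (intro CollectI exI[of _ "fst a"] exI[of _ "fst b"]) auto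
      moreover have "a \<noteq> b" using ab(4) by blast
      ultimately show "A \<in> ?R" using ab by auto
    next
      fix A assume A: "A \<in> ?R"
      then obtain a b where ab: "A = {a, b}" by (auto simp: card_2_iff)
      then have "{fst a, fst b} \<in> ?E" "snd a < m" "snd b < m" using A by auto
      then have "a \<in> {..<n} \<times> {..<m}" "b \<in> {..<n} \<times> {..<m}" "fst a \<noteq> fst b"
        by (auto simp: E doubleton_eq_iff mem_Times_iff)
      then have "\<exists>u v. A = {u, v} \<and> u \<in> {..<n} \<times> {..<m} \<and> v \<in> {..<n} \<times> {..<m} \<and> fst u \<noteq> fst v"
        using ab by blast
      then show "A \<in> ?L" by (simp add: complete_equipartite_graph_def)
    qed
    then have "edges (cover lam m n)
        = (\<Union>p\<in>?E. {(A, s). card A = 2 \<and> fst ` A = p \<and> snd ` A \<subseteq> {..<m} \<and> s < lam})"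
      by (auto simp: multiple_def)
    also have "\<dots> = (\<Union>p\<in>?E. \<Union>t<lam * m. \<Phi> p t)" using un by simp
    finally show ?thesis by auto
  qed
  have disj: "disjoint_family_on (\<lambda>(p, t). \<Phi> p t) (?E \<times> {..<lam * m})"
    unfolding disjoint_family_on_def
  proof (intro ballI impI equals0I)
    fix e e' f assume e: "e \<in> ?E \<times> {..<lam * m}" "e' \<in> ?E \<times> {..<lam * m}" "e \<noteq> e'"
      and "f \<in> (case e of (p, t) \<Rightarrow> \<Phi> p t) \<inter> (case e' of (p, t) \<Rightarrow> \<Phi> p t)"
    then have f: "f \<in> \<Phi> (fst e) (snd e)" "f \<in> \<Phi> (fst e') (snd e')" by (auto split: prod.splits)
    have p: "fst e = fst e'" using pr[OF _ _ f(1)] pr[OF _ _ f(2)] e by auto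
    then have s: "snd e \<noteq> snd e'" using e(3) by (simp add: prod_eq_iff)
    have "disjoint_family_on (\<Phi> (fst e)) {..<lam * m}"
      using \<Phi>[of "fst e"] e(1) by (auto simp: pair_lift_def)
    then have "\<Phi> (fst e) (snd e) \<inter> \<Phi> (fst e) (snd e') = {}"
      using s e(1,2) by (intro disjoint_family_onD[of "\<Phi> (fst e)"]) auto
    then show False using f unfolding p[symmetric] by blast
  qed
  have "\<exists>!f. f \<in> \<Phi> p t \<and> (u, x) \<in> fst f" if "p \<in> ?E" "t < lam * m" "u \<in> p" "x < m" for p t u x
    using \<Phi>[OF that(1)] that by (simp add: pair_lift_def)
  moreover have "multigraph (base lam m n)" "multigraph (cover lam m n)"
    by (auto intro: multigraph_multiple multigraph_complete_graph multigraph_complete_equipartite_graph)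
  moreover have "ends (base lam m n) = fst" "ends (cover lam m n) = fst"
    "verts (cover lam m n) = verts (base lam m n) \<times> {..<m}" "edges (base lam m n) = ?E \<times> {..<lam * m}"
    by (auto simp: multiple_def complete_graph_def complete_equipartite_graph_def)
  ultimately show ?thesis
    using edges disj pr by (auto simp: covering_def split: prod.splits)
qed

text \<open>The monodromy to be prescribed, with one cycle of length \<open>q j\<close> for each \<open>j\<close>.\<close>

lemma blockwise_cyclic_permutation:
  fixes b :: "'j \<Rightarrow> nat \<Rightarrow> nat"
  assumes q: "\<And>j. j \<in> J \<Longrightarrow> q j > 0"
    and b: "bij_betw (\<lambda>(j, y). b j y) (Sigma J (\<lambda>j. {..<q j})) {..<m}"
  shows "\<exists>\<sigma>. bij_betw \<sigma> {..<m} {..<m} \<and> (\<forall>j\<in>J. \<forall>y<q j. \<sigma> (b j y) = b j (Suc y mod q j))"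
proof -
  let ?X = "Sigma J (\<lambda>j. {..<q j})"
  let ?b = "\<lambda>(j, y). b j y"
  define \<sigma> where "\<sigma> x = (case inv_into ?X ?b x of (j, y) \<Rightarrow> b j (Suc y mod q j))" for x
  have eq: "\<sigma> (b j y) = b j (Suc y mod q j)" if "j \<in> J" "y < q j" for j y
  proof -
    have "inv_into ?X ?b (?b (j, y)) = (j, y)"
      using that by (intro inv_into_f_f bij_betw_imp_inj_on[OF b]) auto
    then show ?thesis by (simp add: \<sigma>_def)
  qed
  have surj: "?b ` ?X = {..<m}" using b by (simp add: bij_betw_def)
  have bm: "b j y < m" if "j \<in> J" "y < q j" for j y using surj that by fastforce
  have im: "\<sigma> ` {..<m} = {..<m}"
  proof (intro equalityI subsetI)
    fix z assume "z \<in> \<sigma> ` {..<m}"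
    then obtain x where "z = \<sigma> x" "x \<in> ?b ` ?X" using surj by auto
    then obtain j y where "j \<in> J" "y < q j" "z = \<sigma> (b j y)" by auto
    then show "z \<in> {..<m}" using eq bm q by simp
  next
    fix z assume "z \<in> {..<m}"
    then obtain j y where jy: "j \<in> J" "y < q j" "z = b j y" using surj[symmetric] by auto
    define y' where "y' = (if y = 0 then q j - 1 else y - 1)"
    have "y' < q j" "Suc y' mod q j = y" using jy q[OF jy(1)] by (auto simp: y'_def)
    then have "z = \<sigma> (b j y')" "b j y' < m" using eq bm jy by auto
    then show "z \<in> \<sigma> ` {..<m}" by auto
  qed
  then have "bij_betw \<sigma> {..<m} {..<m}" by (auto simp: bij_betw_def intro: eq_card_imp_inj_on)
  then show ?thesis using eq by blast
qed

section \<open>Prescribing the lift of a cycle\<close>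

text \<open>Walk around the cycle from \<open>v\<close>, and let the last edge lead from \<open>a\<close> back to \<open>v\<close>. The new
  matching over it undoes the transport along the other edges and then applies the wanted
  permutation \<open>\<sigma>\<close>. This works as long as the other edges do not join \<open>v\<close> and \<open>a\<close>, that is for \<open>c \<noteq> 2\<close>;
  for \<open>c = 2\<close> the only other edge also gets a new matching, which is prescribed as the identity.\<close>

lemma redo_pair_for_cycle:
  fixes b :: "'j \<Rightarrow> nat \<Rightarrow> nat"
  assumes lam: "lam > 0"
    and \<Phi>: "\<And>p. p \<in> edges (complete_graph n) \<Longrightarrow> pair_lift lam m p (\<Phi> p)"
    and S: "subgraph S (base lam m n)" "is_cycle c S" and v: "v \<in> verts S"
    and q: "\<And>j. j \<in> J \<Longrightarrow> q j > 0"
    and q2: "\<And>j. lam = 1 \<Longrightarrow> c = 2 \<Longrightarrow> j \<in> J \<Longrightarrow> q j \<ge> 2"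
    and b: "bij_betw (\<lambda>(j, y). b j y) (Sigma J (\<lambda>j. {..<q j})) {..<m}"
  shows "\<exists>p \<Psi>. v \<in> p \<and> pair_lift lam m p \<Psi> \<and>
    (\<exists>D. vertex_disjoint_union (lift m (cover lam m n) (\<lambda>(p', t). (\<Phi>(p := \<Psi>)) p' t) S) J D \<and>
      (\<forall>j\<in>J. is_cycle (q j * c) (D j)))"
proof -
  have reg: "regular 2 S" and c2: "c \<ge> 2" using S(2) by (auto simp: is_cycle_def)
  obtain w e where w0: "w 0 = v" and w: "bij_betw w {..<c} (verts S)"
    and e: "bij_betw e {..<c} (edges S)"
    and ends: "\<And>l. l < c \<Longrightarrow> ends S (e l) = {w l, w (Suc l mod c)}"
    using cycle_sequence[OF S(2) v] by blast
  have winj: "w l = w l' \<longleftrightarrow> l = l'" if "l < c" "l' < c" for l l'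
    using bij_betw_imp_inj_on[OF w] that by (auto simp: inj_on_def)
  have eS: "e l \<in> edges S" if "l < c" for l using e that by (auto simp: bij_betw_def)
  have eG: "e l \<in> edges (base lam m n)" if "l < c" for l
    using S(1) eS[OF that] by (auto simp: subgraph_def)
  have snd_e: "snd (e l) < lam * m" if "l < c" for l using eG[OF that] by (auto simp: multiple_def)
  have endsG: "ends (base lam m n) = fst" "ends (cover lam m n) = fst"
    by (auto simp: multiple_def complete_graph_def complete_equipartite_graph_def)
  have fst_e: "fst (e l) = {w l, w (Suc l mod c)}" if "l < c" for l
    using S(1) eS[OF that] ends[OF that] endsG by (simp add: subgraph_def)
  let ?a = "w (c - 1)"
  define p where "p = {v, ?a}"
  have av: "?a \<noteq> v" using winj[of "c - 1" 0] c2 w0 by simp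
  have last: "fst (e (c - 1)) = {?a, v}" using fst_e[of "c - 1"] c2 w0 by simp
  have pE: "p \<in> edges (complete_graph n)"
    using eG[of "c - 1"] last c2 by (auto simp: multiple_def p_def insert_commute)
  have not_p: "fst (e l) \<noteq> p" if l: "Suc l < c" "c \<noteq> 2" for l
  proof
    assume "fst (e l) = p"
    then have "{w l, w (Suc l)} = {w 0, w (c - 1)}" using fst_e[of l] l w0 by (simp add: p_def)
    then consider "w l = w 0" "w (Suc l) = w (c - 1)" | "w l = w (c - 1)"
      by (metis doubleton_eq_iff)
    then show False
    proof cases
      case 1
      then have "l = 0" "Suc l = c - 1" using winj[of l 0] winj[of "Suc l" "c - 1"] l(1) by auto
      then show False using l(2) by simp
    next
      case 2
      then have "l = c - 1" using winj[of l "c - 1"] l(1) by simp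
      then show False using l(1) by simp
    qed
  qed
  have cov0: "covering (base lam m n) m (cover lam m n) (\<lambda>(p, t). \<Phi> p t)"
    using \<Phi> by (rule covering_of_pair_lifts)
  \<comment> \<open>The matchings over the edges before the last one. For \<open>c = 2\<close> the only such edge lies over \<open>p\<close>; its
    matching is about to be replaced and is settled in advance to be the identity.\<close>
  have "\<exists>\<rho>. bij_betw \<rho> {..<m} {..<m} \<and> (if c = 2 then \<rho> = id
      else matching_along fst (case e l of (p, t) \<Rightarrow> \<Phi> p t) m (w l) (w (Suc l)) \<rho>)"
    if l: "Suc l < c" for l
  proof (cases "c = 2")
    case False
    have "w l \<noteq> w (Suc l)" using winj[of l "Suc l"] l by simp
    then show ?thesis
      using False covering_matching[OF cov0 eG[of l], of "w l" "w (Suc l)"] fst_e[of l] l endsG by simp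
  qed auto
  then obtain \<rho> where \<rho>: "\<And>l. Suc l < c \<Longrightarrow> bij_betw (\<rho> l) {..<m} {..<m}"
    and \<rho>2: "\<And>l. Suc l < c \<Longrightarrow> c = 2 \<Longrightarrow> \<rho> l = id"
    and \<rho>3: "\<And>l. Suc l < c \<Longrightarrow> c \<noteq> 2 \<Longrightarrow>
      matching_along fst (case e l of (p, t) \<Rightarrow> \<Phi> p t) m (w l) (w (Suc l)) (\<rho> l)"
    by metis
  define \<theta> where "\<theta> = rec_nat id (\<lambda>l g. \<rho> l \<circ> g)"
  have \<theta>0: "\<theta> 0 = id" and \<theta>Suc: "\<And>l. \<theta> (Suc l) = \<rho> l \<circ> \<theta> l" by (simp_all add: \<theta>_def)
  have \<theta>bij: "bij_betw (\<theta> l) {..<m} {..<m}" if "l < c" for l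
    using that by (induction l) (auto simp: \<theta>0 \<theta>Suc intro: bij_betw_trans \<rho>)
  obtain \<sigma> where \<sigma>: "bij_betw \<sigma> {..<m} {..<m}"
    and \<sigma>b: "\<And>j y. j \<in> J \<Longrightarrow> y < q j \<Longrightarrow> \<sigma> (b j y) = b j (Suc y mod q j)"
    using blockwise_cyclic_permutation[OF q b] by blast
  let ?i = "inv_into {..<m} (\<theta> (c - 1))"
  have \<theta>l: "bij_betw (\<theta> (c - 1)) {..<m} {..<m}" using \<theta>bij c2 by simp
  define \<rho>' where "\<rho>' = \<sigma> \<circ> ?i"
  have \<rho>': "bij_betw \<rho>' {..<m} {..<m}"
    unfolding \<rho>'_def by (rule bij_betw_trans[OF bij_betw_inv_into[OF \<theta>l] \<sigma>])
  have mono: "\<rho>' (\<theta> (c - 1) x) = \<sigma> x" if "x < m" for x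
    using that bij_betw_imp_inj_on[OF \<theta>l] by (simp add: \<rho>'_def)
  let ?t = "snd (e (c - 1))" and ?s = "snd (e 0)"
  define T where "T = (if c = 2 then {?s, ?t} else {?t})"
  define \<tau> where "\<tau> t = (if t = ?t then \<rho>' else id)" for t
  have st: "?s \<noteq> ?t" if "c = 2"
  proof
    assume "?s = ?t"
    moreover have "fst (e 0) = fst (e (c - 1))" using fst_e[of 0] last that w0 by (auto simp: insert_commute)
    ultimately have "e 0 = e (c - 1)" by (simp add: prod_eq_iff)
    then show False using inj_onD[OF bij_betw_imp_inj_on[OF e], of 0 "c - 1"] that by simp
  qed
  \<comment> \<open>The prescribed matchings must not overuse an edge. Two of them can do so only for \<open>lam = 1\<close>, where
    they are the identity and \<open>\<sigma>\<close>; these are disjoint because \<open>\<sigma>\<close> has no fixed point.\<close>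
  have "card {t \<in> T. \<tau> t x = y} \<le> lam" if xy: "x < m" "y < m" for x y
  proof (cases "lam = 1 \<and> c = 2")
    case True
    then have "\<theta> (c - 1) = id" using \<theta>0 \<theta>Suc[of 0] \<rho>2[of 0] by simp
    then have "\<rho>' x = \<sigma> x" using mono[OF xy(1)] by simp
    moreover have "\<sigma> x \<noteq> x"
    proof -
      have "x \<in> (\<lambda>(j, y). b j y) ` Sigma J (\<lambda>j. {..<q j})"
        using bij_betw_imp_surj_on[OF b] xy(1) by simp
      then obtain j z where jz: "j \<in> J" "z < q j" "x = b j z" by auto
      have "q j \<ge> 2" using q2 True jz(1) by blast
      then have "Suc z mod q j < q j" "Suc z mod q j \<noteq> z" using jz(2)
        by (auto simp: mod_Suc)
      then have "b j (Suc z mod q j) \<noteq> b j z"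
        using bij_betw_imp_inj_on[OF b] jz by (force simp: inj_on_def)
      then show ?thesis using \<sigma>b jz by simp
    qed
    ultimately have "{t \<in> T. \<tau> t x = y} \<subseteq> {if y = x then ?s else ?t}"
      by (auto simp: T_def \<tau>_def split: if_splits)
    from card_mono[OF _ this] show ?thesis using lam by simp
  next
    case False
    have "card {t \<in> T. \<tau> t x = y} \<le> card T" by (rule card_mono) (auto simp: T_def)
    also have "\<dots> \<le> lam" using False lam by (auto simp: T_def card_insert_if)
    finally show ?thesis .
  qed
  moreover have "T \<subseteq> {..<lam * m}" using snd_e c2 by (auto simp: T_def)
  moreover have "bij_betw (\<tau> t) {..<m} {..<m}" for t using \<rho>' by (simp add: \<tau>_def)
  ultimately obtain \<Psi> where \<Psi>: "pair_lift lam m {?a, v} \<Psi>"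
    and \<Psi>T: "\<And>t. t \<in> T \<Longrightarrow> matching_along fst (\<Psi> t) m ?a v (\<tau> t)"
    using pair_lift_exists[OF av, of T lam m \<tau>] by metis
  define \<Phi>' where "\<Phi>' = (\<lambda>(p', t). (\<Phi>(p := \<Psi>)) p' t)"
  have \<Phi>'_eq: "\<Phi>' e = (if fst e = p then \<Psi> (snd e) else (case e of (p, t) \<Rightarrow> \<Phi> p t))" for e
    by (cases e) (simp add: \<Phi>'_def)
  have pl: "pair_lift lam m p \<Psi>" using \<Psi> by (simp add: p_def insert_commute)
  have cov: "covering (base lam m n) m (cover lam m n) \<Phi>'"
    unfolding \<Phi>'_def by (rule covering_of_pair_lifts) (use \<Phi> pl in auto)
  have "\<exists>D. vertex_disjoint_union (lift m (cover lam m n) \<Phi>' S) J D \<and> (\<forall>j\<in>J. is_cycle (q j * c) (D j))"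
  proof (rule lift_of_cycle[OF cov S(1) reg c2 w e _ \<theta>bij _ _ q b])
    fix l assume l: "l < c"
    show "matching_along (ends (cover lam m n)) (\<Phi>' (e l)) m (w l) (w (Suc l mod c)) ((\<rho>(c - 1 := \<rho>')) l)"
    proof -
      consider "l = c - 1" | "Suc l < c" "c \<noteq> 2" | "l = 0" "c = 2" using l by linarith
      then show ?thesis
      proof cases
        case 1
        have "\<Phi>' (e l) = \<Psi> ?t"
          using 1 last by (simp add: \<Phi>'_eq p_def insert_commute)
        moreover have "Suc l mod c = 0" using 1 c2 by simp
        ultimately show ?thesis using \<Psi>T[of ?t] 1 w0 endsG by (simp add: T_def \<tau>_def)
      next
        case 2
        have "\<Phi>' (e l) = (case e l of (p, t) \<Rightarrow> \<Phi> p t)"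
          using not_p[OF 2] by (simp add: \<Phi>'_eq)
        moreover have "l \<noteq> c - 1" using 2 by simp
        ultimately show ?thesis using \<rho>3[OF 2] 2 endsG by simp
      next
        case 3
        have "fst (e l) = p" using fst_e[of l] 3 w0 by (simp add: p_def)
        then have "\<Phi>' (e l) = \<Psi> ?s" using 3 by (simp add: \<Phi>'_eq)
        moreover have "matching_along fst (\<Psi> ?s) m v ?a id"
          using \<Psi>T[of ?s] 3 st by (simp add: T_def \<tau>_def matching_along_def insert_commute)
        ultimately show ?thesis using 3 w0 \<rho>2[of 0] endsG by simp
      qed
    qed
  next
    show "\<theta> 0 x = x" for x by (simp add: \<theta>0)
    show "(\<rho>(c - 1 := \<rho>')) l (\<theta> l x) = \<theta> (Suc l) x" if "Suc l < c" for l x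
    proof -
      have "l \<noteq> c - 1" using that by simp
      then show ?thesis by (simp add: \<theta>Suc)
    qed
    fix j y assume jy: "j \<in> J" "y < q j"
    then have "b j y < m" using bij_betw_imp_surj_on[OF b] by fastforce
    then show "(\<rho>(c - 1 := \<rho>')) (c - 1) (\<theta> (c - 1) (b j y)) = b j (Suc y mod q j)"
      using mono \<sigma>b[OF jy] by simp
  qed
  then show ?thesis using pl unfolding \<Phi>'_def p_def by blast
qed

section \<open>Lifting the cycle decomposition\<close>

lemma exists_block_enumeration:
  fixes q :: "'j \<Rightarrow> nat"
  assumes "finite J" "(\<Sum>j\<in>J. q j) = m"
  shows "\<exists>b. bij_betw (\<lambda>(j, y). b j y) (Sigma J (\<lambda>j. {..<q j})) {..<m}"
proof -
  have "card (Sigma J (\<lambda>j. {..<q j})) = m" using assms by (simp add: card_SigmaI)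
  then obtain h where "bij_betw h (Sigma J (\<lambda>j. {..<q j})) {..<m}"
    using finite_same_card_bij[of "Sigma J (\<lambda>j. {..<q j})" "{..<m}"] assms(1) by auto
  then show ?thesis by (intro exI[of _ "\<lambda>j y. h (j, y)"]) (simp add: case_prod_unfold)
qed

lemma degree_base:
  assumes "v < n"
  shows "degree (base lam m n) v = lam * m * (n - 1)"
proof -
  have "{e \<in> edges (base lam m n). v \<in> ends (base lam m n) e}
      = (\<lambda>u. {u, v}) ` ({..<n} - {v}) \<times> {..<lam * m}"
    using assms by (auto simp: multiple_def complete_graph_def)
  moreover have "inj_on (\<lambda>u. {u, v}) ({..<n} - {v})" by (auto simp: inj_on_def doubleton_eq_iff)
  ultimately show ?thesis using assms by (simp add: degree_def card_cartesian_product card_image)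
qed

theorem theorem4p2:
  fixes lam m n k N :: nat
    and c r :: "nat \<Rightarrow> nat"
    and q :: "nat \<Rightarrow> nat \<Rightarrow> nat"
    and C :: "nat \<Rightarrow> (nat, nat set \<times> nat) mgraph"
  assumes "lam > 0" and "m > 0" and "n > 0" and "k > 0"
    and "\<forall>i\<in>{1..k}. c i > 0"
    and "cycle_decomposition (multiple (lam * m) (complete_graph n)) k c C"
    and "1 \<le> N" and "N < k"
    and "\<forall>i\<in>{1..N}. \<exists>v\<in>verts (C i). v \<notin> (\<Union>j\<in>{1..<i}. verts (C j))"
    and "\<forall>i\<in>{1..N}. r i > 0"
    and "\<forall>i\<in>{1..N}. \<forall>j\<in>{1..r i}. q i j > 0"
    and "\<forall>i\<in>{1..N}. (\<Sum>j=1..r i. q i j) = m"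
    and "\<forall>i\<in>{1..N}. lam = 1 \<and> c i = 2 \<longrightarrow> (\<forall>j\<in>{1..r i}. q i j \<ge> 2)"
  shows "\<exists>F.
    (if odd (lam * m * (n - 1))
     then decomposition_plus_one_factor (multiple lam (complete_equipartite_graph n m)) {1..k} F
     else decomposition (multiple lam (complete_equipartite_graph n m)) {1..k} F) \<and>
    (\<forall>i\<in>{1..k}. regular 2 (F i) \<and> card (edges (F i)) = c i * m) \<and>
    (\<forall>i\<in>{1..N}. \<exists>D. vertex_disjoint_union (F i) {1..r i} D \<and>
       (\<forall>j\<in>{1..r i}. is_cycle (q i j * c i) (D j)))"
proof -
  let ?G = "base lam m n" and ?H = "cover lam m n"
  have cyc: "is_cycle (c i) (C i)" if "i \<in> {1..k}" for i
    using assms(6) that by (simp add: cycle_decomposition_def)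
  \<comment> \<open>All degrees of \<open>\<lambda>mK\<^sub>n\<close> are \<open>\<lambda>m(n - 1)\<close>, so its parity decides which kind of decomposition is given.\<close>
  have dec: "if odd (lam * m * (n - 1)) then decomposition_plus_one_factor ?G {1..k} C
    else decomposition ?G {1..k} C"
  proof -
    have "0 \<in> verts ?G" using assms(3) by (simp add: multiple_def complete_graph_def)
    then show ?thesis
      using assms(6) degree_base[OF assms(3), of lam m] unfolding cycle_decomposition_def by metis
  qed
  have sub: "subgraph (C i) ?G" if i: "i \<in> {1..k}" for i
  proof (cases "odd (lam * m * (n - 1))")
    case True
    then obtain J where "decomposition ?G (insert None (Some ` {1..k})) (case_option J C)"
      using dec by (auto simp: decomposition_plus_one_factor_def)
    then have "subgraph (case Some i of None \<Rightarrow> J | Some i \<Rightarrow> C i) ?G"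
      using i unfolding decomposition_def by blast
    then show ?thesis by simp
  qed (use dec i in \<open>simp add: decomposition_def\<close>)
  define L where "L \<Phi> i = lift m ?H (\<lambda>(p, t). \<Phi> p t) (C i)"
    for \<Phi> :: "nat set \<Rightarrow> nat \<Rightarrow> ((nat \<times> nat) set \<times> nat) set" and i
  \<comment> \<open>A cycle that misses \<open>v\<close> has no edges in a pair containing \<open>v\<close>.\<close>
  have L_upd: "L (\<Phi>(p := \<Psi>)) i = L \<Phi> i" if "v \<in> p" "v \<notin> verts (C i)" "i \<in> {1..k}" for \<Phi> p \<Psi> v i
  proof -
    have fst_e: "fst e \<noteq> p" if "e \<in> edges (C i)" for e
    proof -
      have "ends ?G e = fst e" by (simp add: multiple_def complete_graph_def)
      then have "ends (C i) e = fst e"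
        using sub[OF \<open>i \<in> {1..k}\<close>] that by (simp add: subgraph_def)
      moreover have "ends (C i) e \<subseteq> verts (C i)"
        using sub[OF \<open>i \<in> {1..k}\<close>] that unfolding subgraph_def multigraph_def by blast
      ultimately show ?thesis using \<open>v \<in> p\<close> \<open>v \<notin> verts (C i)\<close> by blast
    qed
    have "(\<Union>e\<in>edges (C i). case e of (p', t) \<Rightarrow> (\<Phi>(p := \<Psi>)) p' t)
        = (\<Union>e\<in>edges (C i). case e of (p', t) \<Rightarrow> \<Phi> p' t)"
    proof (rule SUP_cong[OF refl])
      fix e assume "e \<in> edges (C i)"
      from fst_e[OF this] show "(case e of (p', t) \<Rightarrow> (\<Phi>(p := \<Psi>)) p' t) = (case e of (p', t) \<Rightarrow> \<Phi> p' t)"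
        by (cases e) simp
    qed
    then show ?thesis by (simp add: L_def lift_def)
  qed
  have "\<exists>\<Phi>. (\<forall>p\<in>edges (complete_graph n). pair_lift lam m p (\<Phi> p)) \<and>
      (\<forall>i\<in>{1..s}. \<exists>D. vertex_disjoint_union (L \<Phi> i) {1..r i} D \<and>
        (\<forall>j\<in>{1..r i}. is_cycle (q i j * c i) (D j)))" if "s \<le> N" for s
    using that
  proof (induction s)
    case 0
    have "\<exists>\<Psi>. pair_lift lam m p \<Psi>" if p: "p \<in> edges (complete_graph n)" for p
    proof -
      obtain u v where "p = {u, v}" "u \<noteq> v" using p by (auto simp: complete_graph_def)
      then show ?thesis using pair_lift_exists[of u v "{}" lam m] by auto
    qed
    then show ?case by (simp, metis)
  next
    case (Suc s)
    from Suc.IH[OF Suc_leD[OF Suc.prems]]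
    obtain \<Phi> where \<Phi>: "\<And>p. p \<in> edges (complete_graph n) \<Longrightarrow> pair_lift lam m p (\<Phi> p)"
      and IH: "\<And>i. i \<in> {1..s} \<Longrightarrow> \<exists>D. vertex_disjoint_union (L \<Phi> i) {1..r i} D \<and>
        (\<forall>j\<in>{1..r i}. is_cycle (q i j * c i) (D j))" by blast
    have i: "Suc s \<in> {1..N}" "Suc s \<in> {1..k}" using Suc.prems assms(8) by auto
    obtain v where v: "v \<in> verts (C (Suc s))" "\<And>j. j \<in> {1..s} \<Longrightarrow> v \<notin> verts (C j)"
      using assms(9) i by fastforce
    obtain b where b: "bij_betw (\<lambda>(j, y). b j y) (Sigma {1..r (Suc s)} (\<lambda>j. {..<q (Suc s) j})) {..<m}"
      using exists_block_enumeration[of "{1..r (Suc s)}" "q (Suc s)" m] assms(12) i(1) by auto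
    have "\<exists>p \<Psi>. v \<in> p \<and> pair_lift lam m p \<Psi> \<and>
      (\<exists>D. vertex_disjoint_union (lift m ?H (\<lambda>(p', t). (\<Phi>(p := \<Psi>)) p' t) (C (Suc s))) {1..r (Suc s)} D \<and>
        (\<forall>j\<in>{1..r (Suc s)}. is_cycle (q (Suc s) j * c (Suc s)) (D j)))"
      using assms(1) \<Phi> sub[OF i(2)] cyc[OF i(2)] v(1) _ _ b
    proof (rule redo_pair_for_cycle)
      show "q (Suc s) j > 0" if "j \<in> {1..r (Suc s)}" for j using assms(11) i(1) that by blast
      show "q (Suc s) j \<ge> 2" if "lam = 1" "c (Suc s) = 2" "j \<in> {1..r (Suc s)}" for j
        using assms(13) i(1) that by blast
    qed
    then obtain p \<Psi> where p: "v \<in> p" "pair_lift lam m p \<Psi>"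
      and new: "\<exists>D. vertex_disjoint_union (L (\<Phi>(p := \<Psi>)) (Suc s)) {1..r (Suc s)} D \<and>
        (\<forall>j\<in>{1..r (Suc s)}. is_cycle (q (Suc s) j * c (Suc s)) (D j))"
      unfolding L_def by blast
    have "\<exists>D. vertex_disjoint_union (L (\<Phi>(p := \<Psi>)) i) {1..r i} D \<and>
        (\<forall>j\<in>{1..r i}. is_cycle (q i j * c i) (D j))" if "i \<in> {1..Suc s}" for i
    proof (cases "i = Suc s")
      case False
      then have "i \<in> {1..s}" "i \<in> {1..k}" using that \<open>Suc s \<in> {1..k}\<close> by auto
      then show ?thesis using IH[of i] L_upd[OF p(1) v(2)] by simp
    qed (use new in simp)
    moreover have "pair_lift lam m p' ((\<Phi>(p := \<Psi>)) p')" if "p' \<in> edges (complete_graph n)" for p'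
      using \<Phi>[OF that] p(2) by simp
    ultimately show ?case by blast
  qed
  then obtain \<Phi> where \<Phi>: "\<And>p. p \<in> edges (complete_graph n) \<Longrightarrow> pair_lift lam m p (\<Phi> p)"
    and comp: "\<forall>i\<in>{1..N}. \<exists>D. vertex_disjoint_union (L \<Phi> i) {1..r i} D \<and>
        (\<forall>j\<in>{1..r i}. is_cycle (q i j * c i) (D j))" by blast
  have cov: "covering ?G m ?H (\<lambda>(p, t). \<Phi> p t)" using \<Phi> by (rule covering_of_pair_lifts)
  have "if odd (lam * m * (n - 1)) then decomposition_plus_one_factor ?H {1..k} (L \<Phi>)
     else decomposition ?H {1..k} (L \<Phi>)"
    using dec decomposition_lift[OF cov, of "{1..k}" C]
      decomposition_plus_one_factor_lift[OF cov, of "{1..k}" C] unfolding L_def by presburger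
  moreover have "regular 2 (L \<Phi> i) \<and> card (edges (L \<Phi> i)) = c i * m" if i: "i \<in> {1..k}" for i
    using regular_lift[OF cov sub[OF i]] card_edges_lift[OF cov sub[OF i]] cyc[OF i]
    by (simp add: L_def is_cycle_def)
  ultimately show ?thesis using comp by blast
qed

end
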